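(* Let $L(z)$ be a normalized variable node degree distribution from a node perspective with minimum degree $l_1\ge2$ and average degree $\bar l$. Suppose $\mathbf H_{n\times n}$ is uniformly picked from the ensemble $\mathcal H_{n,L(z)}$, and let $1\le b\le n/\Delta$. Then for any $x^n\in\{0,1\}^n$, $x^n\ne0^n$, with support set $\varkappa$, $$\Pr\Big\{\mathbf H^{(b\Delta)}_{b\Delta\times n}x^n=0^{b\Delta}\Big\}\le\exp\Big\{nP\Big(\frac{b\Delta}n,\bar l,\bar l^{\varkappa}\Big)+\frac{3n\lceil\bar l\rceil}{b\Delta}\ln(n\hat l^{\varkappa})+\frac12\ln\Big[n\bar l^{\varkappa}\Big(1-\frac{\bar l^{\varkappa}}{\bar l}\Big)\Big]+O(1)\Big\},$$ where $\hat l^{\varkappa}=\max\{\frac1n,\min\{\bar l^{\varkappa},\bar l-\bar l^{\varkappa}\}\}$ and, for any $\frac{b\Delta}{n}$, $\bar l$ and $\xi\in(0,\bar l]$, $P(\frac{b\Delta}n,\bar l,\xi)$ is defined as follows. With $R=\frac{b\Delta}n$ and $c,\theta_1,\theta_2,\theta_3,\theta_4,\pi,g,r_1,r_2$ as in the context, let $\xi_{\max}=\bar l-\theta_1\pi(cr_1)-\theta_3\pi(cr_2)$. For $\xi\le\xi_{\max}$, $$P(R,\bar l,\xi)=-\bar l\,\mathrm H_e(\xi/\bar l)-\xi\ln\tau+\theta_1\ln\tfrac{g(\tau,r_1c)}2+\theta_2\ln\tfrac{g(\tau,2r_1c)}2+\theta_3\ln\tfrac{g(\tau,r_2c)}2+\theta_4\ln\tfrac{g(\tau,2r_2c)}2,$$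 in which $\tau$ is the solution to $$r_1c\,\theta_1\tfrac{g(\tau,r_1c-1)}{g(\tau,r_1c)}+2r_1c\,\theta_2\tfrac{g(\tau,2r_1c-1)}{g(\tau,2r_1c)}+r_2c\,\theta_3\tfrac{g(\tau,r_2c-1)}{g(\tau,r_2c)}+2r_2c\,\theta_4\tfrac{g(\tau,2r_2c-1)}{g(\tau,2r_2c)}=\bar l-\xi;$$ for $\xi=\xi_{\max}$ the solution is $\tau=+\infty$ and the expression for $P$ is understood as its limit as $\tau\to+\infty$, i.e. $P(R,\bar l,\xi_{\max})=-\bar l\,\mathrm H_e(\xi_{\max}/\bar l)+\theta_1\pi(cr_1)\ln(cr_1)+\theta_3\pi(cr_2)\ln(cr_2)$. For $\xi_{\max}<\xi\le\bar l$, $P(R,\bar l,\xi)=-\infty$, with the convention $e^{-\infty}=0$.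
   Context: **Degree distributions.** A normalized variable node degree distribution (from a node perspective) is a polynomial $L(z)=\sum_{i=1}^{L}L_iz^{l_i}$ with integers $1\le l_1<\dots<l_L$, $L_i>0$, $\sum_iL_i=1$; $l_1$ is its minimum degree and $\bar l=L'(1)=\sum_iL_il_i$. Put $r_1=\lfloor\bar l\rfloor$, $r_2=\lceil\bar l\rceil$, $R_1=1+\lfloor\bar l\rfloor-\bar l$, $R_2=\bar l-\lfloor\bar l\rfloor$. **Auxiliary functions and quantities.** $\mathrm H_e$ is the binary entropy function in base $e$. $\pi(m)=0$ for even $m$, $1$ for odd $m$; $g(\tau,k)=(1+\tau)^k+(1-\tau)^k$, with $\tau\ge0$. For $R=\frac{b\Delta}n\in(0,1]$ let $c=2^{-\lceil\log_2R\rceil}$ and $\theta_1=\min\{2R-\frac1c,\frac{R_1}{c}\}$, $\theta_2=\max\{\frac{R_1}{2c}-(R-\frac1{2c}),0\}$, $\theta_3=\max\{\frac{R_2}{c}-2(\frac1c-R),0\}$, $\theta_4=\min\{\frac1c-R,\frac{R_2}{2c}\}$. **Standing assumptions.** $n=2^T$ is a power of 2 for which $L_in$ and $R_1n$ are integers; $\Delta=\Delta_n$ is a positive integer with $n/\Delta$ an integer and $\Delta_n/\sqrt n\to1$. $O(1)$ is the usual asymptotic notation as $n\to\infty$, with $L(z)$ fixed. Matrix-vector products are over $\mathbf{GF}(2)$. **Ensemble.** $\mathcal H_{n,L(z)}$ is the set of $n\times n$ 0-1 matrices with row sums and column sums nondecreasing in the index, having exactly $L_in$ columns of sum $l_i$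 for each $i$, with the first $R_1n$ rows of sum $r_1$ and the remaining $R_2n$ rows of sum $r_2$. **Support quantities.** The support set $\varkappa$ of $x^n$ is the set of positions of its nonzero entries. $L_i^{\varkappa}n$ is the number of columns with index in $\varkappa$ having column sum $l_i$ (this depends only on $L(z)$ and $\varkappa$, as columns are ordered by degree), and $\bar l^{\varkappa}=\sum_iL_i^{\varkappa}l_i$. **Accumulated matrices.** For $1\le i\le n$ let $j_i=2(i-2^{\lfloor\log_2i\rfloor})+1$. Partition $\{1,\dots,n\}$ into consecutive blocks $\Lambda_{i,1},\dots,\Lambda_{i,i}$: for $1\le k<j_i$, $\Lambda_{i,k}=\{(k-1)2^{T-\lceil\log_2i\rceil}+1,\dots,k2^{T-\lceil\log_2i\rceil}\}$; for $j_i\le k\le i$, $\Lambda_{i,k}$ is the set of integers from $(j_i-1)2^{T-\lceil\log_2i\rceil}+(k-j_i)2^{T-\lfloor\log_2i\rfloor}+1$ to $(j_i-1)2^{T-\lceil\log_2i\rceil}+(k-j_i+1)2^{T-\lfloor\log_2i\rfloor}$. $\mathbf H^{(i)}_{i\times n}$ is the $i\times n$ matrix whose $k$-th row is the mod-2 sum of the rows of $\mathbf H_{n\times n}$ with index in $\Lambda_{i,k}$.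
   Formalization: When x is the all-ones vector, the last logarithm is ln 0; it is read as 0 here. Read as −∞ the bound would be 0, which fails e.g. for L(z)=z^4, where every row has even weight and the probability is 1. *)

theory Defs
  imports
    "HOL-Analysis.Analysis"
    "HOL-Computational_Algebra.Polynomial"
    "HOL-Library.Extended_Real"
    "HOL-Library.Landau_Symbols"
    "HOL-Library.Z2"
    "Jordan_Normal_Form.Matrix"
begin

unbundle no vec_syntax

text \<open>The term $L_i z^{l_i}$ of the distribution is the nonzero coefficient
  \<open>coeff L l\<close> at \<open>l = l_i\<close>.\<close>

definition degree_distribution :: "real poly \<Rightarrow> bool" where
  "degree_distribution L \<longleftrightarrow>
     coeff L 0 = 0 \<and> (\<forall>l. coeff L l \<ge> 0) \<and> (\<Sum>l\<le>degree L. coeff L l) = 1"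

definition min_deg :: "real poly \<Rightarrow> nat" where
  "min_deg L = Min {l. coeff L l \<noteq> 0}"

definition avg_deg :: "real poly \<Rightarrow> real" where
  "avg_deg L = poly (pderiv L) 1"

definition r1 :: "real \<Rightarrow> nat" where "r1 lb = nat \<lfloor>lb\<rfloor>"
definition r2 :: "real \<Rightarrow> nat" where "r2 lb = nat \<lceil>lb\<rceil>"
definition R1 :: "real \<Rightarrow> real" where "R1 lb = 1 + of_int \<lfloor>lb\<rfloor> - lb"
definition R2 :: "real \<Rightarrow> real" where "R2 lb = lb - of_int \<lfloor>lb\<rfloor>"

definition admissible :: "real poly \<Rightarrow> nat \<Rightarrow> nat \<Rightarrow> bool" where
  "admissible L \<Delta> n \<longleftrightarrow>
     (\<exists>T. n = 2 ^ T) \<and> (\<forall>l. coeff L l * real n \<in> \<int>) \<and> R1 (avg_deg L) * real n \<in> \<int> \<and>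
     \<Delta> > 0 \<and> \<Delta> dvd n"

text \<open>0-1 matrices are matrices over the two-element field \<^typ>\<open>bit\<close>; row and column sums are
  taken in the natural numbers. Indices of matrices and vectors start at 0.\<close>

definition row_sum :: "bit mat \<Rightarrow> nat \<Rightarrow> nat" where
  "row_sum H i = card {j. j < dim_col H \<and> H $$ (i, j) = 1}"

definition col_sum :: "bit mat \<Rightarrow> nat \<Rightarrow> nat" where
  "col_sum H j = card {i. i < dim_row H \<and> H $$ (i, j) = 1}"

definition ensemble :: "nat \<Rightarrow> real poly \<Rightarrow> bit mat set" where
  "ensemble n L = {H \<in> carrier_mat n n.
     (\<forall>i j. i \<le> j \<longrightarrow> j < n \<longrightarrow> row_sum H i \<le> row_sum H j) \<and>
     (\<forall>i j. i \<le> j \<longrightarrow> j < n \<longrightarrow> col_sum H i \<le> col_sum H j) \<and>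
     (\<forall>l. real (card {j. j < n \<and> col_sum H j = l}) = coeff L l * real n) \<and>
     (\<forall>i<n. row_sum H i =
        (if real i < R1 (avg_deg L) * real n then r1 (avg_deg L) else r2 (avg_deg L)))}"

definition supp :: "bit Matrix.vec \<Rightarrow> nat set" where
  "supp x = {j. j < dim_vec x \<and> vec_index x j \<noteq> 0}"

text \<open>The sum of column \<open>j\<close>, common to all members of the ensemble
  (see \<open>col_sum_ensemble\<close> below).\<close>

definition col_deg :: "nat \<Rightarrow> real poly \<Rightarrow> nat \<Rightarrow> nat" where
  "col_deg n L j = (LEAST d. real j < (\<Sum>l\<le>d. coeff L l * real n))"

lemma col_sum_ensemble:
  assumes H: "H \<in> ensemble n L" and j: "j < n"
  shows "col_sum H j = col_deg n L j"
proof -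
  have mono: "col_sum H i \<le> col_sum H k" if "i \<le> k" "k < n" for i k
    using H that by (auto simp: ensemble_def)
  have cnt: "real (card {i. i < n \<and> col_sum H i = l}) = coeff L l * real n" for l
    using H by (auto simp: ensemble_def)
  have tot: "real (card {i. i < n \<and> col_sum H i \<le> d}) = (\<Sum>l\<le>d. coeff L l * real n)" for d
  proof -
    have "{i. i < n \<and> col_sum H i \<le> d} = (\<Union>l\<le>d. {i. i < n \<and> col_sum H i = l})"
      by auto
    then have "card {i. i < n \<and> col_sum H i \<le> d} = (\<Sum>l\<le>d. card {i. i < n \<and> col_sum H i = l})"
      by (simp only:) (rule card_UN_disjoint, auto)
    then show ?thesis by (simp add: cnt)
  qed
  have iff: "real j < (\<Sum>l\<le>d. coeff L l * real n) \<longleftrightarrow> col_sum H j \<le> d" for d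
  proof
    assume "col_sum H j \<le> d"
    then have "{..j} \<subseteq> {i. i < n \<and> col_sum H i \<le> d}"
      using mono j by (auto intro: order_trans)
    then have "card {..j} \<le> card {i. i < n \<and> col_sum H i \<le> d}"
      by (intro card_mono) auto
    then show "real j < (\<Sum>l\<le>d. coeff L l * real n)"
      unfolding tot[symmetric] by simp
  next
    assume a: "real j < (\<Sum>l\<le>d. coeff L l * real n)"
    show "col_sum H j \<le> d"
    proof (rule ccontr)
      assume "\<not> col_sum H j \<le> d"
      then have "{i. i < n \<and> col_sum H i \<le> d} \<subseteq> {..<j}"
        using mono by (auto simp: not_le) (meson leD leI le_less_trans)
      then have "card {i. i < n \<and> col_sum H i \<le> d} \<le> card {..<j}"
        by (intro card_mono) auto
      with a show False unfolding tot[symmetric] by simp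
    qed
  qed
  show ?thesis
    unfolding col_deg_def iff by (rule Least_equality[symmetric]) auto
qed

definition Lsup :: "nat \<Rightarrow> real poly \<Rightarrow> nat set \<Rightarrow> nat \<Rightarrow> real" where
  "Lsup n L \<kappa> l = real (card {j \<in> \<kappa>. col_deg n L j = l}) / real n"

definition avg_deg_supp :: "nat \<Rightarrow> real poly \<Rightarrow> nat set \<Rightarrow> real" where
  "avg_deg_supp n L \<kappa> = (\<Sum>l\<le>degree L. Lsup n L \<kappa> l * real l)"

definition hat_deg_supp :: "nat \<Rightarrow> real poly \<Rightarrow> nat set \<Rightarrow> real" where
  "hat_deg_supp n L \<kappa> =
     max (1 / real n) (min (avg_deg_supp n L \<kappa>) (avg_deg L - avg_deg_supp n L \<kappa>))"

text \<open>Here \<open>n = 2 ^ T\<close> and \<open>1 \<le> i \<le> n\<close>, so both logarithms round to exponents in \<open>{0..T}\<close>.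
  Blocks consist of 1-based row indices and are numbered \<open>k = 1, \<dots>, i\<close>; this accounts for the
  shifts in \<open>acc_mat\<close>.\<close>

definition clog :: "nat \<Rightarrow> nat" where "clog i = nat \<lceil>log 2 (real i)\<rceil>"
definition flog :: "nat \<Rightarrow> nat" where "flog i = nat \<lfloor>log 2 (real i)\<rfloor>"

definition acc_j :: "nat \<Rightarrow> nat" where
  "acc_j i = 2 * (i - 2 ^ flog i) + 1"

definition acc_block :: "nat \<Rightarrow> nat \<Rightarrow> nat \<Rightarrow> nat set" where
  "acc_block T i k =
     (if k < acc_j i
      then {(k - 1) * 2 ^ (T - clog i) + 1 .. k * 2 ^ (T - clog i)}
      else {(acc_j i - 1) * 2 ^ (T - clog i) + (k - acc_j i) * 2 ^ (T - flog i) + 1 ..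
            (acc_j i - 1) * 2 ^ (T - clog i) + (k - acc_j i + 1) * 2 ^ (T - flog i)})"

definition acc_mat :: "nat \<Rightarrow> nat \<Rightarrow> bit mat \<Rightarrow> bit mat" where
  "acc_mat T i H =
     mat i (2 ^ T) (\<lambda>(k, j). \<Sum>r\<in>acc_block T i (k + 1). H $$ (r - 1, j))"

definition He :: "real \<Rightarrow> real" where
  "He p = - p * ln p - (1 - p) * ln (1 - p)"

definition par :: "nat \<Rightarrow> real" where
  "par m = (if even m then 0 else 1)"

definition g :: "real \<Rightarrow> nat \<Rightarrow> real" where
  "g \<tau> k = (1 + \<tau>) ^ k + (1 - \<tau>) ^ k"

text \<open>For \<open>0 < R \<le> 1\<close> the number $c = 2^{-\lceil \log_2 R \rceil}$ is a positive integer.\<close>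

definition cfac :: "real \<Rightarrow> nat" where
  "cfac R = 2 ^ nat (- \<lceil>log 2 R\<rceil>)"

definition theta1 :: "real \<Rightarrow> real \<Rightarrow> real" where
  "theta1 R lb = min (2 * R - 1 / real (cfac R)) (R1 lb / real (cfac R))"

definition theta2 :: "real \<Rightarrow> real \<Rightarrow> real" where
  "theta2 R lb = max (R1 lb / (2 * real (cfac R)) - (R - 1 / (2 * real (cfac R)))) 0"

definition theta3 :: "real \<Rightarrow> real \<Rightarrow> real" where
  "theta3 R lb = max (R2 lb / real (cfac R) - 2 * (1 / real (cfac R) - R)) 0"

definition theta4 :: "real \<Rightarrow> real \<Rightarrow> real" where
  "theta4 R lb = min (1 / real (cfac R) - R) (R2 lb / (2 * real (cfac R)))"

definition xi_max :: "real \<Rightarrow> real \<Rightarrow> real" where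
  "xi_max R lb =
     lb - theta1 R lb * par (cfac R * r1 lb) - theta3 R lb * par (cfac R * r2 lb)"

definition tau_eq :: "real \<Rightarrow> real \<Rightarrow> real \<Rightarrow> real \<Rightarrow> bool" where
  "tau_eq R lb \<xi> \<tau> \<longleftrightarrow>
     (let k1 = r1 lb * cfac R; k2 = r2 lb * cfac R in
        real k1 * theta1 R lb * (g \<tau> (k1 - 1) / g \<tau> k1) +
        2 * real k1 * theta2 R lb * (g \<tau> (2 * k1 - 1) / g \<tau> (2 * k1)) +
        real k2 * theta3 R lb * (g \<tau> (k2 - 1) / g \<tau> k2) +
        2 * real k2 * theta4 R lb * (g \<tau> (2 * k2 - 1) / g \<tau> (2 * k2)) = lb - \<xi>)"

definition tau :: "real \<Rightarrow> real \<Rightarrow> real \<Rightarrow> real" where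
  "tau R lb \<xi> = (THE \<tau>. \<tau> \<ge> 0 \<and> tau_eq R lb \<xi> \<tau>)"

text \<open>At \<open>\<xi> = xi_max R lb\<close> the solution is $\tau = +\infty$, and the value is the limit of the
  generic expression.\<close>

definition Pexp :: "real \<Rightarrow> real \<Rightarrow> real \<Rightarrow> ereal" where
  "Pexp R lb \<xi> =
     (let k1 = r1 lb * cfac R; k2 = r2 lb * cfac R; \<tau> = tau R lb \<xi> in
      if \<xi> < xi_max R lb then
        ereal (- lb * He (\<xi> / lb) - \<xi> * ln \<tau> +
               theta1 R lb * ln (g \<tau> k1 / 2) + theta2 R lb * ln (g \<tau> (2 * k1) / 2) +
               theta3 R lb * ln (g \<tau> k2 / 2) + theta4 R lb * ln (g \<tau> (2 * k2) / 2))
      else if \<xi> = xi_max R lb then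
        ereal (- lb * He (\<xi> / lb) +
               theta1 R lb * par k1 * ln (real k1) + theta3 R lb * par k2 * ln (real k2))
      else - \<infinity>)"

definition eexp :: "ereal \<Rightarrow> ereal" where
  "eexp x = (case x of ereal r \<Rightarrow> ereal (exp r) | PInfty \<Rightarrow> \<infinity> | MInfty \<Rightarrow> 0)"

text \<open>The finite correction terms. When the support is the whole index set, the argument of the
  last logarithm is 0; the library value \<open>ln 0 = 0\<close> then makes the term vanish. This is intended:
  the term comes from Stirling's formula for a binomial coefficient, which equals 1 in that case,
  and with $\ln 0 = -\infty$ the bound would be 0 although the probability can be 1.\<close>

definition corr :: "nat \<Rightarrow> nat \<Rightarrow> real poly \<Rightarrow> nat set \<Rightarrow> real" where
  "corr n i L \<kappa> =
     3 * real n * of_int \<lceil>avg_deg L\<rceil> / real i * ln (real n * hat_deg_supp n L \<kappa>) +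
     1 / 2 * ln (real n * avg_deg_supp n L \<kappa> * (1 - avg_deg_supp n L \<kappa> / avg_deg L))"

end

theory Submission
  imports Defs
begin

text \<open>
  Encode a matrix with the prescribed sums as an assignment of its column sockets to rows: column \<open>j\<close>
  has as many sockets as its column sum, and row \<open>i\<close> is hit as often as its row sum. Every matrix of
  the ensemble comes from the same number of assignments that are injective on each column, and
  a switching argument shows that the proportion of these among all assignments is bounded away
  from 0; hence the uniform matrix may be replaced by a uniform assignment at the cost of a factor
  \<open>O(1)\<close>. For assignments the probability that every block receives an even number of
  sockets of the support is, by symmetry, the number of \<open>w\<close>-subsets of the \<open>m\<close> sockets that meet
  every block evenly, divided by \<open>m choose w\<close>. The generating function of these subsets is the
  product of the factors \<open>g \<tau> d / 2\<close> over the blocks, so that each \<open>\<tau> > 0\<close> gives a bound; the factors of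
  blocks mixing both row degrees are interpolated by Hoelder's inequality, which makes the
  exponents exactly \<open>n \<theta>\<^sub>i\<close>. Stirling's formula bounds the binomial coefficient. For \<open>\<xi> \<ge> \<xi>\<^sub>m\<^sub>a\<^sub>x\<close> one lets
  \<open>\<tau>\<close> tend to infinity.
\<close>

section \<open>Switching\<close>

text \<open>The entries of a uniform matrix with prescribed sums are not exchangeable; sockets are,
  and that is why assignments replace matrices. The price stays bounded because all row and column
  sums are bounded in terms of \<open>L\<close> alone: making one column repetition-free costs a
  factor \<open>1 - O(1/n)\<close>, and there are \<open>n\<close> columns. The factor of a block
  containing both row degrees depends on how the degrees mix, whereas \<open>Pexp\<close> has only
  pure factors. Hoelder gives each row of a block of size \<open>s\<close> the factor
  \<open>g \<tau> (s * d) / 2\<close> to the power \<open>1/s\<close>. For \<tau> > 1 this needs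
  \<open>s = 1\<close> or \<open>s\<close> even, which holds because block sizes are powers of two.
  The derivative of \<open>ln (g \<tau> k)\<close> times \<tau> equals
  \<open>k - k * g \<tau> (k - 1) / g \<tau> k\<close>. So \<open>tau_eq\<close> is the stationarity
  condition in \<tau> for the exponent of the bound obtained from \<tau>. The proof has to show that
  its nonnegative solution is unique and positive, so that \<open>tau\<close> denotes a \<tau> for
  which the bound is available. The value \<open>xi_max\<close> is the growth exponent in \<tau> of
  the interpolated product, per row of the matrix. Beyond it a power of \<tau> with negative
  exponent remains, and the probability is forced to be 0.\<close>

lemma card_filter_comp_transpose:
  assumes "finite S" "a \<in> S" "d \<in> S"
  shows "card {s\<in>S. P (f (Transposition.transpose a d s))} = card {s\<in>S. P (f s)}"
proof -
  let ?p = "Transposition.transpose a d"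
  have S: "?p s \<in> S \<longleftrightarrow> s \<in> S" for s
    using assms by (auto simp: Transposition.transpose_def)
  have "bij_betw ?p {s\<in>S. P (f (?p s))} {s\<in>S. P (f s)}"
    by (rule bij_betw_byWitness[where f' = ?p]) (auto simp: S)
  then show ?thesis by (rule bij_betw_same_card)
qed

definition assignments :: "'a set \<Rightarrow> 'b set \<Rightarrow> ('b \<Rightarrow> nat) \<Rightarrow> ('a \<Rightarrow> 'b) set" where
  "assignments S I d = {f \<in> S \<rightarrow>\<^sub>E I. \<forall>i\<in>I. card {s\<in>S. f s = i} = d i}"

text \<open>The set \<open>C\<close> of columns is a parameter so that freedom from repetitions can
  be imposed one column at a time.\<close>

definition simple_on :: "'a set \<Rightarrow> ('a \<Rightarrow> 'c) \<Rightarrow> 'c set \<Rightarrow> ('a \<Rightarrow> 'b) \<Rightarrow> bool" where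
  "simple_on S cl C f \<longleftrightarrow> (\<forall>c\<in>C. inj_on f {s\<in>S. cl s = c})"

lemma finite_assignments: "finite S \<Longrightarrow> finite I \<Longrightarrow> finite (assignments S I d)"
  unfolding assignments_def by (rule finite_subset[of _ "S \<rightarrow>\<^sub>E I"]) (auto intro: finite_PiE)

lemma assignments_transpose:
  assumes "finite S" "a \<in> S" "b \<in> S" "f \<in> assignments S I d"
  shows "f \<circ> Transposition.transpose a b \<in> assignments S I d"
proof -
  have "f \<circ> Transposition.transpose a b \<in> S \<rightarrow>\<^sub>E I"
    using assms by (auto simp: assignments_def Transposition.transpose_def PiE_def Pi_def extensional_def)
  then show ?thesis
    using assms card_filter_comp_transpose[OF assms(1-3), of "\<lambda>y. y = i" f for i]
    by (auto simp: assignments_def)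
qed

text \<open>Switching: the value of a repeated element of column \<open>c\<close> is exchanged with that of another
  element of \<open>S\<close>; all but \<open>r * l\<close> of the exchanges keep the columns in \<open>C\<close> repetition-free.\<close>

lemma switching_step:
  fixes S :: "'a set" and I :: "'b set" and cl :: "'a \<Rightarrow> 'c"
  assumes fin: "finite S" "finite I"
    and l: "\<And>c. card {s\<in>S. cl s = c} \<le> l"
    and r: "\<And>i. i \<in> I \<Longrightarrow> d i \<le> r"
    and c: "c \<notin> C"
  defines "D \<equiv> \<lambda>C. {f \<in> assignments S I d. simple_on S cl C f}"
  shows "card (D C - D (insert c C)) * (card S - r * l) \<le> card (D C) * (l * l * r)"
proof -
  let ?tr = "Transposition.transpose :: 'a \<Rightarrow> 'a \<Rightarrow> 'a \<Rightarrow> 'a"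
  define Sc where "Sc = {s\<in>S. cl s = c}"
  define Bad where "Bad = D C - D (insert c C)"
  have finD: "finite (D X)" for X
    unfolding D_def using finite_assignments[OF fin] by simp
  have finBad: "finite Bad" unfolding Bad_def using finD by simp
  have "\<exists>p. fst p \<in> Sc \<and> snd p \<in> Sc \<and> fst p \<noteq> snd p \<and> f (fst p) = f (snd p)" if "f \<in> Bad" for f
    using that by (auto simp: Bad_def D_def simple_on_def inj_on_def Sc_def)
  then obtain p where p: "\<And>f. f \<in> Bad \<Longrightarrow>
      fst (p f) \<in> Sc \<and> snd (p f) \<in> Sc \<and> fst (p f) \<noteq> snd (p f) \<and> f (fst (p f)) = f (snd (p f))"
    by metis
  define G where "G f = {e\<in>S. f \<circ> ?tr (fst (p f)) e \<in> D C}" for f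
  \<comment> \<open>The record that makes switching injective: both positions of the repeated value
    and the exchange partner. An exchange is an involution, so the record and the result give back
    the original. After the exchange \<open>e\<close> carries the same value as \<open>a'\<close>,
    hence lies in one given row and has at most \<open>r\<close> choices.\<close>
  define X where "X f' = {(a, a', e). a \<in> Sc \<and> a' \<in> Sc \<and> e \<in> S \<and> f' e = f' a'}" for f' :: "'a \<Rightarrow> 'b"
  have finG: "finite (G f)" for f using fin by (simp add: G_def)
  have rowcard: "card {e\<in>S. f e = i} \<le> r" if "f \<in> assignments S I d" "i \<in> I" for f i
    using that r by (auto simp: assignments_def)
  have cardG: "card S - r * l \<le> card (G f)" if f: "f \<in> Bad" for f
  proof -
    define a where "a = fst (p f)"
    have a: "a \<in> S" "cl a = c" using p[OF f] by (auto simp: a_def Sc_def)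
    have fA: "f \<in> assignments S I d" using f by (simp add: Bad_def D_def)
    have faI: "f a \<in> I" using fA a by (auto simp: assignments_def PiE_def Pi_def)
    \<comment> \<open>Moving the value \<open>f a\<close> to \<open>e\<close> can create a
      repetition only if the column of \<open>e\<close> already holds that value; \<open>U\<close>
      collects these \<open>e\<close>. The value arriving at \<open>a\<close> lands in column
      \<open>c\<close>, which is outside \<open>C\<close>.\<close>
    define U where "U = (\<Union>s\<in>{s\<in>S. f s = f a}. {e\<in>S. cl e = cl s})"
    have "card U \<le> (\<Sum>s\<in>{s\<in>S. f s = f a}. card {e\<in>S. cl e = cl s})"
      unfolding U_def using fin by (intro card_UN_le) simp
    also have "\<dots> \<le> (\<Sum>s\<in>{s\<in>S. f s = f a}. l)" by (intro sum_mono l)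
    also have "\<dots> \<le> r * l" using rowcard[OF fA faI] by simp
    finally have U: "card U \<le> r * l" .
    have "S - U \<subseteq> G f"
    proof
      fix e assume e: "e \<in> S - U"
      let ?f = "f \<circ> ?tr a e"
      have "?f \<in> assignments S I d"
        using fin a e fA by (intro assignments_transpose) auto
      moreover have "inj_on ?f {s\<in>S. cl s = c'}" if c': "c' \<in> C" for c'
      proof -
        have ne: "c' \<noteq> cl a" using c c' a by auto
        have inj: "inj_on f {s\<in>S. cl s = c'}"
          using f c' by (auto simp: Bad_def D_def simple_on_def)
        show ?thesis
        proof (cases "cl e = c'")
          case False
          then show ?thesis using inj ne
            by (auto simp: inj_on_def Transposition.transpose_def)
        next
          case True
          have "f s \<noteq> f a" if "s \<in> S" "cl s = c'" for s
            using e True that by (auto simp: U_def)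
          then show ?thesis using inj ne True a
            by (auto simp: inj_on_def Transposition.transpose_def) metis+
        qed
      qed
      ultimately show "e \<in> G f" using e by (auto simp: G_def D_def simple_on_def a_def)
    qed
    then have "card (S - U) \<le> card (G f)" by (intro card_mono finG)
    moreover have "card S - card U \<le> card (S - U)"
      by (rule diff_card_le_card_Diff) (auto simp: U_def fin)
    ultimately show ?thesis using U by linarith
  qed
  have finX: "finite (X f')" for f'
    by (rule finite_subset[of _ "S \<times> S \<times> S"]) (auto simp: X_def Sc_def fin)
  have cardX: "card (X f') \<le> l * l * r" if f': "f' \<in> D C" for f'
  proof -
    have "X f' = (SIGMA a:Sc. SIGMA a':Sc. {e\<in>S. f' e = f' a'})" by (auto simp: X_def)
    then have "card (X f') = card Sc * (\<Sum>a'\<in>Sc. card {e\<in>S. f' e = f' a'})"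
      using fin by (simp add: card_SigmaI Sc_def)
    also have "\<dots> \<le> card Sc * (\<Sum>a'\<in>Sc. r)"
      using f' by (intro mult_le_mono2 sum_mono rowcard)
        (auto simp: D_def Sc_def assignments_def PiE_def Pi_def)
    also have "\<dots> = card Sc * card Sc * r" by simp
    also have "\<dots> \<le> l * l * r" using l[of c] unfolding Sc_def by (intro mult_le_mono) auto
    finally show ?thesis .
  qed
  define h where "h = (\<lambda>(f, e). (f \<circ> ?tr (fst (p f)) e, (fst (p f), snd (p f), e)))"
  have "inj_on h (Sigma Bad G)"
  proof (rule inj_onI, clarsimp simp: h_def)
    fix f e f2
    assume eq: "f \<circ> ?tr (fst (p f2)) e = f2 \<circ> ?tr (fst (p f2)) e"
    have "f x = f2 x" for x
      using fun_cong[OF eq, of "?tr (fst (p f2)) e x"] by simp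
    then show "f = f2" by (rule ext)
  qed
  moreover have "h ` Sigma Bad G \<subseteq> Sigma (D C) X"
  proof (rule image_subsetI)
    fix z assume "z \<in> Sigma Bad G"
    then obtain f e where z: "z = (f, e)" and f: "f \<in> Bad" and e: "e \<in> G f" by blast
    define a a' where "a = fst (p f)" and "a' = snd (p f)"
    have a: "a \<in> Sc" "a' \<in> Sc" "a \<noteq> a'" "f a = f a'" using p[OF f] by (auto simp: a_def a'_def)
    have "(f \<circ> ?tr a e) e = (f \<circ> ?tr a e) a'"
      using a by (simp add: Transposition.transpose_def)
    moreover have "f \<circ> ?tr a e \<in> D C" "e \<in> S" using e by (simp_all add: G_def a_def)
    ultimately have "(a, a', e) \<in> X (f \<circ> ?tr a e)" using a by (simp add: X_def)
    with \<open>f \<circ> ?tr a e \<in> D C\<close> show "h z \<in> Sigma (D C) X"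
      by (simp add: z h_def a_def a'_def)  qed
  ultimately have "card (Sigma Bad G) \<le> card (Sigma (D C) X)"
    by (intro card_inj_on_le[where f = h]) (auto intro: finD finX)
  moreover have "card Bad * (card S - r * l) \<le> card (Sigma Bad G)"
    using finBad finG sum_mono[of Bad "\<lambda>_. card S - r * l" "\<lambda>f. card (G f)"] cardG
    by (simp add: card_SigmaI)
  moreover have "card (Sigma (D C) X) \<le> card (D C) * (l * l * r)"
    using finD finX sum_mono[of "D C" "\<lambda>f. card (X f)" "\<lambda>_. l * l * r"] cardX
    by (simp add: card_SigmaI)
  ultimately show ?thesis unfolding Bad_def by linarith
qed

text \<open>Induction over the columns, each costing one factor. The 2 in the factor arises because
  \<open>2 * r * l \<le> card S\<close> makes \<open>card S - r * l\<close> in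
  \<open>switching_step\<close> at least half of \<open>card S\<close>.\<close>

lemma switching_bound:
  fixes S :: "'a set" and I :: "'b set" and cl :: "'a \<Rightarrow> 'c"
  assumes fin: "finite S" "finite I" "finite C"
    and l: "\<And>c. card {s\<in>S. cl s = c} \<le> l"
    and r: "\<And>i. i \<in> I \<Longrightarrow> d i \<le> r"
    and big: "card S \<ge> 2 * r * l" "card S \<ge> 4 * l * l * r" "card S > 0"
  shows "(1 - 2 * real (l * l * r) / real (card S)) ^ card C * real (card (assignments S I d))
     \<le> real (card {f \<in> assignments S I d. simple_on S cl C f})"
  using fin(3)
proof (induction C rule: finite_induct)
  case empty
  then show ?case by (simp add: simple_on_def)
next
  case (insert c C)
  let ?D = "\<lambda>C. {f \<in> assignments S I d. simple_on S cl C f}"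
  let ?q = "2 * real (l * l * r) / real (card S)"
  have finD: "finite (?D X)" for X using finite_assignments[OF fin(1,2)] by simp
  have sub: "?D (insert c C) \<subseteq> ?D C" by (auto simp: simple_on_def)
  have "card (?D C - ?D (insert c C)) * (card S - r * l) \<le> card (?D C) * (l * l * r)"
    by (rule switching_step[OF fin(1,2) l r insert(2)])
  then have "real (card (?D C - ?D (insert c C)) * (card S - r * l)) \<le> real (card (?D C) * (l * l * r))"
    by (rule of_nat_mono)
  moreover have "real (card S) / 2 \<le> real (card S - r * l)"
  proof -
    have "r * l \<le> card S" using big by linarith
    then have "real (card S - r * l) = real (card S) - real (r * l)" by (rule of_nat_diff)
    moreover have "2 * real (r * l) \<le> real (card S)"
      using of_nat_mono[OF big(1), where 'a = real] by simp
    ultimately show ?thesis by linarith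
  qed
  then have "real (card (?D C - ?D (insert c C))) * (real (card S) / 2)
     \<le> real (card (?D C - ?D (insert c C))) * real (card S - r * l)"
    by (intro mult_left_mono) auto
  ultimately have "real (card (?D C - ?D (insert c C))) * (real (card S) / 2)
     \<le> real (card (?D C)) * real (l * l * r)"
    by (simp only: of_nat_mult)
  then have "real (card (?D C - ?D (insert c C))) \<le> ?q * real (card (?D C))"
    using big(3) by (simp add: field_simps)
  moreover have "real (card (?D C - ?D (insert c C))) = real (card (?D C)) - real (card (?D (insert c C)))"
    using card_Diff_subset[OF finD[of "insert c C"] sub] card_mono[OF finD sub] by (simp add: of_nat_diff)
  ultimately have step: "(1 - ?q) * real (card (?D C)) \<le> real (card (?D (insert c C)))"
    by (simp add: algebra_simps)
  have "real (4 * l * l * r) \<le> real (card S)" using big(2) by (rule of_nat_mono)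
  then have "?q \<le> 1" using big(3) by (simp add: divide_simps)
  then have "(1 - ?q) * ((1 - ?q) ^ card C * real (card (assignments S I d))) \<le> (1 - ?q) * real (card (?D C))"
    using insert.IH by (intro mult_left_mono) auto
  with step insert(1,2) show ?case by (simp add: mult.assoc)
qed

text \<open>From \<open>ln (1 - q) \<ge> - q - 2 * q^2\<close>, where \<open>2 * q^2 \<le> q\<close>
  for \<open>q \<le> 1/2\<close>.\<close>

lemma power_one_minus_ge_exp:
  fixes q :: real
  assumes "0 \<le> q" "q \<le> 1 / 2"
  shows "exp (- 2 * q * real n) \<le> (1 - q) ^ n"
proof -
  have "- 2 * q \<le> ln (1 - q)"
    using ln_one_minus_pos_lower_bound[of q] assms
      mult_left_mono[of q "1 / 2" q] by (simp add: power2_eq_square)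
  then have "exp (- 2 * q) \<le> 1 - q"
    using assms by (simp add: ln_ge_iff)
  then have "exp (- 2 * q) ^ n \<le> (1 - q) ^ n" by (intro power_mono) auto
  then show ?thesis by (simp add: exp_of_nat_mult[symmetric] mult.commute)
qed

text \<open>There are at most \<open>card S\<close> columns, each losing a proportion of order
  \<open>1 / card S\<close>, so the total loss is a constant depending only on the maximal
  degrees.\<close>

lemma simple_assignments_bound:
  fixes S :: "'a set" and I :: "'b set" and cl :: "'a \<Rightarrow> 'c"
  assumes fin: "finite S" "finite I" "finite C"
    and l: "\<And>c. card {s\<in>S. cl s = c} \<le> l"
    and r: "\<And>i. i \<in> I \<Longrightarrow> d i \<le> r"
    and big: "card S \<ge> 2 * r * l" "card S \<ge> 4 * l * l * r" "card S > 0"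
    and C: "card C \<le> card S"
  shows "real (card (assignments S I d)) \<le>
     exp (4 * real (l * l * r)) * real (card {f \<in> assignments S I d. simple_on S cl C f})"
proof -
  let ?q = "2 * real (l * l * r) / real (card S)"
  let ?k = "real (l * l * r)"
  have "real (4 * l * l * r) \<le> real (card S)" using big(2) by (rule of_nat_mono)
  then have q: "?q \<le> 1 / 2" using big(3) by (simp add: divide_simps)
  have "?q * real (card C) \<le> ?q * real (card S)" using C by (intro mult_left_mono) auto
  then have "?q * real (card C) \<le> 2 * ?k" using big(3) by simp
  then have "exp (- (4 * ?k)) \<le> exp (- 2 * ?q * real (card C))" by simp
  also have "\<dots> \<le> (1 - ?q) ^ card C" using q by (intro power_one_minus_ge_exp) auto
  finally have "exp (- (4 * ?k)) * real (card (assignments S I d)) \<le>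
      (1 - ?q) ^ card C * real (card (assignments S I d))"
    by (intro mult_right_mono) auto
  also have "\<dots> \<le> real (card {f \<in> assignments S I d. simple_on S cl C f})"
    using switching_bound[OF fin l r big] .
  finally show ?thesis by (simp add: exp_minus field_simps)
qed

section \<open>The equation for \<open>\<tau>\<close>\<close>

lemma g_pos: "\<tau> \<ge> 0 \<Longrightarrow> g \<tau> k > 0"
proof -
  assume t: "\<tau> \<ge> 0"
  show ?thesis
  proof (cases "k = 0 \<or> \<tau> = 0")
    case False
    have "- ((1 - \<tau>) ^ k) \<le> \<bar>1 - \<tau>\<bar> ^ k" by (metis abs_ge_minus_self power_abs)
    also have "\<bar>1 - \<tau>\<bar> ^ k < (1 + \<tau>) ^ k"
      using t False by (intro power_strict_mono) auto
    finally show ?thesis by (simp add: g_def)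
  qed (auto simp: g_def)
qed

text \<open>Dividing by \<open>a^2 - b^2\<close> leaves a sum of \<open>N\<close> products with
  geometric mean \<open>(a * b)^(N - 1)\<close>, so this is an arithmetic-geometric mean inequality.
  The induction bounds the two summands of \<open>2 * D (Suc n)\<close> separately, by
  \<open>a^(2*n) + b^(2*n) > 2 * (a * b)^n\<close> and by \<open>a^2 + b^2 \<ge> 2 * a * b\<close>;
  the former gives strictness from \<open>N = 2\<close> on.\<close>

lemma power_diff_ge_middle:
  fixes a b :: real
  assumes "a > b" "b \<ge> 0" "N \<ge> 1"
  shows "real N * (a * b) ^ (N - 1) * (a\<^sup>2 - b\<^sup>2) \<le> a ^ (2 * N) - b ^ (2 * N)"
    and "N \<ge> 2 \<Longrightarrow> real N * (a * b) ^ (N - 1) * (a\<^sup>2 - b\<^sup>2) < a ^ (2 * N) - b ^ (2 * N)"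
proof -
  have ab: "a\<^sup>2 - b\<^sup>2 > 0" using assms by (simp add: power_strict_mono)
  define D where "D n = a ^ (2 * n) - b ^ (2 * n)" for n
  have stp: "real (Suc n) * (a * b) ^ n * (a\<^sup>2 - b\<^sup>2) < D (Suc n)"
    if "n \<ge> 1" "real n * (a * b) ^ (n - 1) * (a\<^sup>2 - b\<^sup>2) \<le> D n" for n
  proof -
    have eq: "2 * D (Suc n) = (a ^ (2*n) + b ^ (2*n)) * (a\<^sup>2 - b\<^sup>2) + (a\<^sup>2 + b\<^sup>2) * D n"
      by (simp add: D_def algebra_simps power2_eq_square)
    have "b ^ n < a ^ n" using assms that by (intro power_strict_mono) auto
    then have "0 < (a ^ n - b ^ n)\<^sup>2" by simp
    then have "2 * (a * b) ^ n < a ^ (2*n) + b ^ (2*n)"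
      by (simp add: power2_diff power_mult[symmetric] power_mult_distrib mult_ac)
    then have 1: "2 * (a * b) ^ n * (a\<^sup>2 - b\<^sup>2) < (a ^ (2*n) + b ^ (2*n)) * (a\<^sup>2 - b\<^sup>2)"
      using ab by (rule mult_strict_right_mono)
    have "2 * (a * b) \<le> a\<^sup>2 + b\<^sup>2" using zero_le_power2[of "a - b"] by (simp add: power2_diff)
    then have "2 * (a * b) * (real n * (a * b) ^ (n - 1) * (a\<^sup>2 - b\<^sup>2)) \<le> (a\<^sup>2 + b\<^sup>2) * D n"
      using that(2) assms ab by (intro mult_mono) auto
    moreover have "2 * (a * b) * (real n * (a * b) ^ (n - 1) * (a\<^sup>2 - b\<^sup>2)) = 2 * real n * (a * b) ^ n * (a\<^sup>2 - b\<^sup>2)"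
      using that(1) by (cases n) simp_all
    ultimately show ?thesis using eq 1 by (simp add: algebra_simps)
  qed
  have weak: "real n * (a * b) ^ (n - 1) * (a\<^sup>2 - b\<^sup>2) \<le> D n" if "n \<ge> 1" for n
    using that
  proof (induction n rule: dec_induct)
    case base
    show ?case by (simp add: D_def)
  next
    case (step n)
    then show ?case using stp[of n] by simp
  qed
  show "real N * (a * b) ^ (N - 1) * (a\<^sup>2 - b\<^sup>2) \<le> a ^ (2 * N) - b ^ (2 * N)"
    using weak[OF assms(3)] by (simp add: D_def)
  show "real N * (a * b) ^ (N - 1) * (a\<^sup>2 - b\<^sup>2) < a ^ (2 * N) - b ^ (2 * N)" if "N \<ge> 2"
    using stp[of "N - 1"] weak[of "N - 1"] that by (simp add: D_def)
qed

text \<open>With \<open>a = 1 + \<tau>\<close> and \<open>b = 1 - \<tau>\<close> this is the sign of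
  the derivative of \<open>gratio\<close>. For \<tau> > 1 the base \<open>b\<close> is negative and
  the last summand may be negative too; the strict inequality for \<open>\<bar>b\<bar>\<close>
  absorbs it.\<close>

lemma power_diff_plus_middle_pos:
  fixes a b :: real
  assumes "a > \<bar>b\<bar>" "N \<ge> 1"
  shows "a ^ (2 * N) - b ^ (2 * N) + real N * (a * b) ^ (N - 1) * (a\<^sup>2 - b\<^sup>2) > 0"
proof (cases "N = 1")
  case True
  have "b\<^sup>2 < a\<^sup>2" using assms by (metis abs_ge_zero power2_abs power_strict_mono pos2)
  then show ?thesis using True by simp
next
  case False
  have "0 \<le> a\<^sup>2 - b\<^sup>2" using assms(1) by (simp add: abs_le_square_iff[symmetric])
  moreover have "- ((a * \<bar>b\<bar>) ^ (N - 1)) \<le> (a * b) ^ (N - 1)"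
    using assms abs_ge_minus_self[of "(a * b) ^ (N - 1)"] by (simp add: power_abs abs_mult)
  then have "real N * - ((a * \<bar>b\<bar>) ^ (N - 1)) \<le> real N * (a * b) ^ (N - 1)"
    by (rule mult_left_mono) simp
  ultimately have "real N * - ((a * \<bar>b\<bar>) ^ (N - 1)) * (a\<^sup>2 - b\<^sup>2) \<le> real N * (a * b) ^ (N - 1) * (a\<^sup>2 - b\<^sup>2)"
    by (rule mult_right_mono[rotated])
  moreover have "real N * (a * \<bar>b\<bar>) ^ (N - 1) * (a\<^sup>2 - b\<^sup>2) < a ^ (2 * N) - b ^ (2 * N)"
    using power_diff_ge_middle(2)[of "\<bar>b\<bar>" a N] assms False by (simp add: power_mult)
  ultimately show ?thesis by simp
qed

text \<open>The quotients in \<open>tau_eq\<close>. Up to the factor \<open>k\<close> they are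
  \<open>k\<close> minus the logarithmic derivative of \<open>g \<tau> k\<close> multiplied by
  \<tau>.\<close>

definition gratio :: "nat \<Rightarrow> real \<Rightarrow> real" where
  "gratio k \<tau> = g \<tau> (k - 1) / g \<tau> k"

text \<open>The index \<open>M + 2\<close> keeps all exponents free of truncated subtraction, and
  the numerator is arranged so that \<open>power_diff_plus_middle_pos\<close> with
  \<open>N = M + 1\<close> decides its sign.\<close>

lemma gratio_has_derivative:
  assumes "\<tau> \<ge> 0"
  defines "a \<equiv> 1 + \<tau>" and "b \<equiv> 1 - \<tau>"
  shows "(gratio (M + 2) has_real_derivative
     - (a ^ (2 * (M + 1)) - b ^ (2 * (M + 1)) + real (M + 1) * (a * b) ^ M * (a\<^sup>2 - b\<^sup>2)) / (g \<tau> (M + 2))\<^sup>2) (at \<tau>)"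
proof -
  have nz: "(1 + \<tau>) ^ (M + 2) + (1 - \<tau>) ^ (M + 2) \<noteq> 0"
    using g_pos[of \<tau> "M + 2"] assms by (simp add: g_def)
  have fe: "gratio (M + 2) = (\<lambda>\<tau>. ((1 + \<tau>) ^ (M + 1) + (1 - \<tau>) ^ (M + 1)) / ((1 + \<tau>) ^ (M + 2) + (1 - \<tau>) ^ (M + 2)))"
    by (simp add: gratio_def g_def fun_eq_iff)
  have dp: "((\<lambda>\<tau>. (1 + \<tau>) ^ Suc j + (1 - \<tau>) ^ Suc j) has_real_derivative
      real (Suc j) * a ^ j - real (Suc j) * b ^ j) (at \<tau>)" for j
  proof -
    have "((\<lambda>\<tau>. (1 + \<tau>) ^ Suc j) has_real_derivative real (Suc j) * a ^ j) (at \<tau>)"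
      unfolding a_def by (rule derivative_eq_intros refl | simp)+
    moreover have "((\<lambda>\<tau>. (1 - \<tau>) ^ Suc j) has_real_derivative - (real (Suc j) * b ^ j)) (at \<tau>)"
      unfolding b_def by (rule derivative_eq_intros refl | simp)+
    ultimately show ?thesis
      unfolding diff_conv_add_uminus[of "real (Suc j) * a ^ j"] by (rule DERIV_add)
  qed
  have "(gratio (M + 2) has_real_derivative
     ((real (M + 1) * a ^ M - real (M + 1) * b ^ M) * (a ^ (M + 2) + b ^ (M + 2))
       - (a ^ (M + 1) + b ^ (M + 1)) * (real (M + 2) * a ^ (M + 1) - real (M + 2) * b ^ (M + 1)))
      / ((a ^ (M + 2) + b ^ (M + 2)) * (a ^ (M + 2) + b ^ (M + 2)))) (at \<tau>)"
    unfolding fe a_def b_def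
    using DERIV_divide[OF dp[of M] dp[of "Suc M"]] nz by (simp add: a_def b_def del: power_Suc)
  moreover have "(real (M + 1) * a ^ M - real (M + 1) * b ^ M) * (a ^ (M + 2) + b ^ (M + 2))
       - (a ^ (M + 1) + b ^ (M + 1)) * (real (M + 2) * a ^ (M + 1) - real (M + 2) * b ^ (M + 1))
     = - (a ^ (2 * (M + 1)) - b ^ (2 * (M + 1)) + real (M + 1) * (a * b) ^ M * (a\<^sup>2 - b\<^sup>2))"
  proof -
    define x y where "x = a ^ M" and "y = b ^ M"
    have "a ^ (M + 1) = x * a" "b ^ (M + 1) = y * b" "a ^ (M + 2) = x * (a * a)" "b ^ (M + 2) = y * (b * b)"
      "(a * b) ^ M = x * y" "a ^ (2 * (M + 1)) = (x * a) * (x * a)" "b ^ (2 * (M + 1)) = (y * b) * (y * b)"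
      by (simp_all add: x_def y_def power_mult_distrib mult_2 mult_2_right power_add mult_ac)
    moreover have "real (M + 1) = real M + 1" "real (M + 2) = real M + 2" by simp_all
    ultimately show ?thesis
      by (simp only: x_def[symmetric] y_def[symmetric] power2_eq_square) (simp add: algebra_simps)
  qed
  ultimately show ?thesis by (simp add: g_def a_def b_def power2_eq_square)
qed

lemma gratio_strict_antimono:
  assumes "k \<ge> 2" "0 \<le> s" "s < t"
  shows "gratio k t < gratio k s"
proof -
  obtain M where k: "k = M + 2" using assms(1) by (metis add.commute le_Suc_ex)
  show ?thesis
    unfolding k
  \<comment> \<open>The derivative vanishes at \<tau> = 0, which may be the left endpoint;
    negativity on the open interval together with continuity suffices.\<close>
  proof (rule DERIV_neg_imp_decreasing_open[OF assms(3)])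
    fix x assume x: "s < x" "x < t"
    then have x0: "x > 0" using assms(2) by simp
    have "(1 + x) ^ (2 * (M + 1)) - (1 - x) ^ (2 * (M + 1))
        + real (M + 1) * ((1 + x) * (1 - x)) ^ M * ((1 + x)\<^sup>2 - (1 - x)\<^sup>2) > 0"
      using power_diff_plus_middle_pos[of "1 - x" "1 + x" "M + 1"] x0 by simp
    moreover have "(g x (M + 2))\<^sup>2 > 0" using g_pos[of x "M + 2"] x0 by simp
    ultimately have "- ((1 + x) ^ (2 * (M + 1)) - (1 - x) ^ (2 * (M + 1))
        + real (M + 1) * ((1 + x) * (1 - x)) ^ M * ((1 + x)\<^sup>2 - (1 - x)\<^sup>2)) / (g x (M + 2))\<^sup>2 < 0"
      by (intro divide_neg_pos) linarith+
    then show "\<exists>y. (gratio (M + 2) has_real_derivative y) (at x) \<and> y < 0"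
      using gratio_has_derivative[of x M, OF less_imp_le[OF x0]] by blast
  next
    show "continuous_on {s..t} (gratio (M + 2))"
      using assms(2) by - (rule DERIV_continuous_on, rule has_field_derivative_at_within,
        rule gratio_has_derivative, simp)
  qed
qed

lemma gratio_continuous_on:
  assumes "k \<ge> 2"
  shows "continuous_on {0..} (gratio k)"
proof -
  obtain M where k: "k = M + 2" using assms(1) by (metis add.commute le_Suc_ex)
  show ?thesis unfolding k
    by (rule DERIV_continuous_on, rule has_field_derivative_at_within, rule gratio_has_derivative) simp
qed

lemma tendsto_one_plus_over: "((\<lambda>\<tau>::real. (1 + \<tau>) / \<tau>) \<longlongrightarrow> 1) at_top"
  and tendsto_one_minus_over: "((\<lambda>\<tau>::real. (1 - \<tau>) / \<tau>) \<longlongrightarrow> - 1) at_top"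
  and tendsto_minus_one_over: "((\<lambda>\<tau>::real. (\<tau> - 1) / \<tau>) \<longlongrightarrow> 1) at_top"
proof -
  have inv: "((\<lambda>\<tau>::real. inverse \<tau>) \<longlongrightarrow> 0) at_top"
    by (rule tendsto_inverse_0_at_top[OF filterlim_ident])
  have ev: "eventually (\<lambda>\<tau>::real. \<tau> > 0) at_top" by (rule eventually_gt_at_top)
  have "((\<lambda>\<tau>::real. inverse \<tau> + 1) \<longlongrightarrow> 0 + 1) at_top"
    and "((\<lambda>\<tau>::real. inverse \<tau> - 1) \<longlongrightarrow> 0 - 1) at_top"
    and "((\<lambda>\<tau>::real. 1 - inverse \<tau>) \<longlongrightarrow> 1 - 0) at_top"
    by (intro tendsto_add tendsto_diff tendsto_const inv)+
  then have "((\<lambda>\<tau>::real. inverse \<tau> + 1) \<longlongrightarrow> 1) at_top"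
    "((\<lambda>\<tau>::real. inverse \<tau> - 1) \<longlongrightarrow> - 1) at_top"
    "((\<lambda>\<tau>::real. 1 - inverse \<tau>) \<longlongrightarrow> 1) at_top" by simp_all
  then show "((\<lambda>\<tau>::real. (1 + \<tau>) / \<tau>) \<longlongrightarrow> 1) at_top"
    "((\<lambda>\<tau>::real. (1 - \<tau>) / \<tau>) \<longlongrightarrow> - 1) at_top"
    "((\<lambda>\<tau>::real. (\<tau> - 1) / \<tau>) \<longlongrightarrow> 1) at_top"
    by - (erule Lim_transform_eventually, intro eventually_mono[OF ev], simp add: field_simps)+
qed

text \<open>For odd \<open>k\<close> the leading terms cancel.\<close>

lemma g_asymp:
  "((\<lambda>\<tau>. g \<tau> k / (2 * \<tau> ^ (if even k then k else k - 1))) \<longlongrightarrow> (if even k then 1 else real k)) at_top"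
proof (cases "even k")
  case True
  have "((\<lambda>\<tau>::real. (((1 + \<tau>) / \<tau>) ^ k + ((1 - \<tau>) / \<tau>) ^ k) / 2) \<longlongrightarrow> (1 ^ k + (- 1) ^ k) / 2) at_top"
    by (intro tendsto_intros tendsto_one_plus_over tendsto_one_minus_over) auto
  moreover have "(((1 + \<tau>) / \<tau>) ^ k + ((1 - \<tau>) / \<tau>) ^ k) / 2 = g \<tau> k / (2 * \<tau> ^ k)" for \<tau> :: real
    by (simp only: power_divide g_def add_divide_distrib[symmetric] divide_divide_eq_left mult.commute)
  ultimately show ?thesis using True by simp
next
  case False
  have "((\<lambda>\<tau>::real. \<Sum>i<k. ((\<tau> - 1) / \<tau>) ^ (k - Suc i) * ((1 + \<tau>) / \<tau>) ^ i) \<longlongrightarrow> (\<Sum>i<k. 1 ^ (k - Suc i) * 1 ^ i)) at_top"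
    by (intro tendsto_sum tendsto_mult tendsto_power tendsto_one_plus_over tendsto_minus_one_over)
  then have lim: "((\<lambda>\<tau>::real. \<Sum>i<k. ((\<tau> - 1) / \<tau>) ^ (k - Suc i) * ((1 + \<tau>) / \<tau>) ^ i) \<longlongrightarrow> real k) at_top"
    by simp
  have "(\<Sum>i<k. ((\<tau> - 1) / \<tau>) ^ (k - Suc i) * ((1 + \<tau>) / \<tau>) ^ i) = g \<tau> k / (2 * \<tau> ^ (k - 1))"
    if "\<tau> > 0" for \<tau> :: real
  proof -
    \<comment> \<open>For odd \<open>k\<close> the sum becomes a difference of powers with the
      factor \<open>(1 + \<tau>) - (\<tau> - 1) = 2\<close>; the \<open>k\<close> remaining products
      each grow like \<open>\<tau> ^ (k - 1)\<close>, which explains the limit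
      \<open>k\<close>.\<close>
    have "(1 - \<tau>) ^ k = - ((\<tau> - 1) ^ k)" using False by (metis minus_diff_eq power_minus_odd)
    then have "g \<tau> k = (1 + \<tau>) ^ k - (\<tau> - 1) ^ k" by (simp add: g_def)
    also have "\<dots> = 2 * (\<Sum>i<k. (\<tau> - 1) ^ (k - Suc i) * (1 + \<tau>) ^ i)"
      by (subst power_diff_sumr2) simp
    finally have "g \<tau> k / (2 * \<tau> ^ (k - 1)) = (\<Sum>i<k. (\<tau> - 1) ^ (k - Suc i) * (1 + \<tau>) ^ i / \<tau> ^ (k - 1))"
      by (simp add: sum_divide_distrib)
    also have "\<dots> = (\<Sum>i<k. ((\<tau> - 1) / \<tau>) ^ (k - Suc i) * ((1 + \<tau>) / \<tau>) ^ i)"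
    proof (rule sum.cong[OF refl])
      fix i assume "i \<in> {..<k}"
      then have "\<tau> ^ (k - 1) = \<tau> ^ (k - Suc i) * \<tau> ^ i" by (simp add: power_add[symmetric])
      then show "(\<tau> - 1) ^ (k - Suc i) * (1 + \<tau>) ^ i / \<tau> ^ (k - 1) = ((\<tau> - 1) / \<tau>) ^ (k - Suc i) * ((1 + \<tau>) / \<tau>) ^ i"
        by (simp add: power_divide)
    qed
    finally show ?thesis by simp
  qed
  then have "((\<lambda>\<tau>. g \<tau> k / (2 * \<tau> ^ (k - 1))) \<longlongrightarrow> real k) at_top"
    by (intro Lim_transform_eventually[OF lim] eventually_mono[OF eventually_gt_at_top[of 0]])
  then show ?thesis using False by simp
qed

text \<open>By \<open>g_asymp\<close>, for even \<open>k\<close> the numerator grows with exponent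
  \<open>k - 2\<close> and the denominator with exponent \<open>k\<close>, so the quotient vanishes.
  For odd \<open>k\<close> both have exponent \<open>k - 1\<close> and the leading coefficients have
  ratio \<open>1 / k\<close>.\<close>

lemma gratio_tendsto:
  assumes "k \<ge> 2"
  shows "((\<lambda>\<tau>. real k * gratio k \<tau>) \<longlongrightarrow> par k) at_top"
proof (cases "even k")
  case True
  have "((\<lambda>\<tau>. real k * (g \<tau> (k - 1) / (2 * \<tau> ^ (k - 1 - 1)) / (g \<tau> k / (2 * \<tau> ^ k)) * (1 / \<tau>\<^sup>2))) \<longlongrightarrow>
      real k * (real (k - 1) / 1 * 0)) at_top"
  proof (intro tendsto_intros)
    show "((\<lambda>\<tau>. g \<tau> (k - 1) / (2 * \<tau> ^ (k - 1 - 1))) \<longlongrightarrow> real (k - 1)) at_top"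
      using g_asymp[of "k - 1"] True assms by simp
    show "((\<lambda>\<tau>. g \<tau> k / (2 * \<tau> ^ k)) \<longlongrightarrow> 1) at_top"
      using g_asymp[of k] True by simp
    have "((\<lambda>\<tau>::real. inverse \<tau> ^ 2) \<longlongrightarrow> 0 ^ 2) at_top"
      by (intro tendsto_power tendsto_inverse_0_at_top filterlim_ident)
    then show "((\<lambda>\<tau>::real. 1 / \<tau>\<^sup>2) \<longlongrightarrow> 0) at_top" by (simp add: inverse_eq_divide power_divide)
  qed simp
  moreover have "real k * (g \<tau> (k - 1) / (2 * \<tau> ^ (k - 1 - 1)) / (g \<tau> k / (2 * \<tau> ^ k)) * (1 / \<tau>\<^sup>2)) = real k * gratio k \<tau>"
    if "\<tau> > 0" for \<tau> :: real
  proof -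
    obtain M where k: "k = M + 2" using assms by (metis add.commute le_Suc_ex)
    show ?thesis using that by (simp add: gratio_def k power2_eq_square)
  qed
  ultimately have "((\<lambda>\<tau>. real k * gratio k \<tau>) \<longlongrightarrow> real k * (real (k - 1) / 1 * 0)) at_top"
    by (elim Lim_transform_eventually) (intro eventually_mono[OF eventually_gt_at_top[of 0]])
  then show ?thesis using True by (simp add: par_def)
next
  case False
  have "((\<lambda>\<tau>. real k * (g \<tau> (k - 1) / (2 * \<tau> ^ (k - 1)) / (g \<tau> k / (2 * \<tau> ^ (k - 1))))) \<longlongrightarrow>
      real k * (1 / real k)) at_top"
  proof (intro tendsto_intros)
    show "((\<lambda>\<tau>. g \<tau> (k - 1) / (2 * \<tau> ^ (k - 1))) \<longlongrightarrow> 1) at_top"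
      using g_asymp[of "k - 1"] False assms by simp
    show "((\<lambda>\<tau>. g \<tau> k / (2 * \<tau> ^ (k - 1))) \<longlongrightarrow> real k) at_top"
      using g_asymp[of k] False by simp
  qed (use assms in simp)
  moreover have "real k * (g \<tau> (k - 1) / (2 * \<tau> ^ (k - 1)) / (g \<tau> k / (2 * \<tau> ^ (k - 1)))) = real k * gratio k \<tau>"
    if "\<tau> > 0" for \<tau> :: real
    using that by (simp add: gratio_def)
  ultimately have "((\<lambda>\<tau>. real k * gratio k \<tau>) \<longlongrightarrow> real k * (1 / real k)) at_top"
    by (elim Lim_transform_eventually) (intro eventually_mono[OF eventually_gt_at_top[of 0]])
  then show ?thesis using False assms by (simp add: par_def)
qed

text \<open>All quotients are 1 at \<tau> = 0, so \<open>y\<close> lies strictly between the limit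
  of \<open>\<Psi>\<close> at infinity (the terms with doubled, hence even, index vanish there) and
  \<open>\<Psi> 0\<close>. The intermediate value theorem gives a solution. Since \<theta>1 or
  \<theta>2 is positive, \<open>\<Psi>\<close> is strictly decreasing, which gives
  uniqueness.\<close>

lemma gratio_sum_solution:
  fixes \<theta>1 \<theta>2 \<theta>3 \<theta>4 y :: real
  assumes k: "k1 \<ge> 2" "k2 \<ge> 2"
    and \<theta>: "\<theta>1 \<ge> 0" "\<theta>2 \<ge> 0" "\<theta>3 \<ge> 0" "\<theta>4 \<ge> 0" "\<theta>1 + 2 * \<theta>2 > 0"
    and y: "\<theta>1 * par k1 + \<theta>3 * par k2 < y" "y < real k1 * (\<theta>1 + 2 * \<theta>2) + real k2 * (\<theta>3 + 2 * \<theta>4)"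
  defines "\<Psi> \<equiv> \<lambda>\<tau>. real k1 * \<theta>1 * gratio k1 \<tau> + 2 * real k1 * \<theta>2 * gratio (2 * k1) \<tau> +
       real k2 * \<theta>3 * gratio k2 \<tau> + 2 * real k2 * \<theta>4 * gratio (2 * k2) \<tau>"
  shows "\<exists>!\<tau>. \<tau> \<ge> 0 \<and> \<Psi> \<tau> = y" and "\<tau> \<ge> 0 \<Longrightarrow> \<Psi> \<tau> = y \<Longrightarrow> \<tau> > 0"
proof -
  have \<Psi>0: "\<Psi> 0 = real k1 * (\<theta>1 + 2 * \<theta>2) + real k2 * (\<theta>3 + 2 * \<theta>4)"
    by (simp add: \<Psi>_def gratio_def g_def algebra_simps)
  have anti: "\<Psi> t < \<Psi> s" if st: "0 \<le> s" "s < t" for s t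
  proof -
    have lt: "gratio k t < gratio k s" if "k \<ge> 2" for k
      using gratio_strict_antimono[OF that st] .
    have le: "real n * \<theta> * gratio k t \<le> real n * \<theta> * gratio k s" if "k \<ge> 2" "\<theta> \<ge> 0" for n k \<theta>
      using lt[OF that(1)] that(2) by (intro mult_left_mono) simp_all
    have less: "real n * \<theta> * gratio k t < real n * \<theta> * gratio k s" if "k \<ge> 2" "\<theta> > 0" "n > 0" for n k \<theta>
      using lt[OF that(1)] that(2,3) by (intro mult_strict_left_mono) simp_all
    have "real k1 * \<theta>1 * gratio k1 t + real (2 * k1) * \<theta>2 * gratio (2 * k1) t
        < real k1 * \<theta>1 * gratio k1 s + real (2 * k1) * \<theta>2 * gratio (2 * k1) s"
    proof (cases "\<theta>1 > 0")
      case True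
      then show ?thesis using less[of k1 \<theta>1 k1] le[of "2 * k1" \<theta>2 "2 * k1"] k \<theta> by linarith
    next
      case False
      then show ?thesis using le[of k1 \<theta>1 k1] less[of "2 * k1" \<theta>2 "2 * k1"] k \<theta> by linarith
    qed
    moreover have "real k2 * \<theta>3 * gratio k2 t \<le> real k2 * \<theta>3 * gratio k2 s"
      "real (2 * k2) * \<theta>4 * gratio (2 * k2) t \<le> real (2 * k2) * \<theta>4 * gratio (2 * k2) s"
      using k \<theta> by (intro le; linarith)+
    ultimately show ?thesis by (simp add: \<Psi>_def)
  qed
  have "((\<lambda>\<tau>. \<theta>1 * (real k1 * gratio k1 \<tau>) + \<theta>2 * (real (2 * k1) * gratio (2 * k1) \<tau>) +
       \<theta>3 * (real k2 * gratio k2 \<tau>) + \<theta>4 * (real (2 * k2) * gratio (2 * k2) \<tau>)) \<longlongrightarrow>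
     \<theta>1 * par k1 + \<theta>2 * par (2 * k1) + \<theta>3 * par k2 + \<theta>4 * par (2 * k2)) at_top"
    using k by (intro tendsto_intros gratio_tendsto) auto
  then have "(\<Psi> \<longlongrightarrow> \<theta>1 * par k1 + \<theta>3 * par k2) at_top"
    by (simp add: \<Psi>_def par_def mult_ac)
  then have "eventually (\<lambda>\<tau>. \<Psi> \<tau> < y \<and> \<tau> > 0) at_top"
    using y(1) by (intro eventually_conj order_tendstoD(2) eventually_gt_at_top)
  then obtain t where t: "\<Psi> t < y" "t > 0" by (auto simp: eventually_at_top_linorder)
  have "continuous_on {0..t} (gratio k)" if "k \<ge> 2" for k
    using gratio_continuous_on[OF that] by (rule continuous_on_subset) auto
  then have "continuous_on {0..t} \<Psi>"
    unfolding \<Psi>_def using k by (intro continuous_intros) auto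
  then have "\<exists>u. 0 \<le> u \<and> u \<le> t \<and> \<Psi> u = y"
    using t y(2) \<Psi>0 by (intro IVT2') simp_all
  then obtain u where u: "0 \<le> u" "\<Psi> u = y" by blast
  show "\<exists>!\<tau>. \<tau> \<ge> 0 \<and> \<Psi> \<tau> = y"
  proof (rule ex1I[of _ u])
    fix v assume "v \<ge> 0 \<and> \<Psi> v = y"
    then show "v = u" using u anti[of u v] anti[of v u] by (cases u v rule: linorder_cases) auto
  qed (use u in simp)
  show "\<tau> > 0" if "\<tau> \<ge> 0" "\<Psi> \<tau> = y"
    using that \<Psi>0 y(2) by (cases "\<tau> = 0") auto
qed

section \<open>Even subsets and averaging\<close>

lemma prod_fibres:
  fixes h :: "'k \<Rightarrow> real"
  assumes "finite K" "finite J" "q ` K \<subseteq> J"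
  shows "(\<Prod>s\<in>K. h (q s)) = (\<Prod>k\<in>J. h k ^ card {s\<in>K. q s = k})"
  using prod.group[OF assms, of "\<lambda>s. h (q s)"] by simp

lemma prod_add_Pow:
  fixes f :: "bool \<Rightarrow> 'k \<Rightarrow> real"
  assumes "finite J"
  shows "(\<Prod>k\<in>J. f True k + f False k) = (\<Sum>U\<in>Pow J. \<Prod>k\<in>J. f (k \<in> U) k)"
  unfolding prod_add[OF assms]
proof (rule sum.cong[OF refl])
  fix U assume U: "U \<in> Pow J"
  have "(\<Prod>k\<in>J. f (k \<in> U) k) = (\<Prod>k\<in>J - U. f (k \<in> U) k) * (\<Prod>k\<in>U. f (k \<in> U) k)"
    using U assms by (intro prod.subset_diff) auto
  then show "(\<Prod>k\<in>U. f True k) * (\<Prod>k\<in>J - U. f False k) = (\<Prod>k\<in>J. f (k \<in> U) k)" by simp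
qed

text \<open>The indicator of all block counts being even is the product of
  \<open>(1 + (-1)^a) / 2\<close> over the blocks. Expanding both sides over sign patterns, with
  \<open>U\<close> the set of blocks of sign +1, and exchanging the sums over \<open>U\<close> and
  \<open>K\<close> identifies them.\<close>

lemma even_generating_function:
  fixes \<tau> :: real
  assumes fin: "finite S" "finite J" and q: "q ` S \<subseteq> J"
  shows "(\<Sum>K | K \<subseteq> S \<and> (\<forall>k\<in>J. even (card {s\<in>K. q s = k})). \<tau> ^ card K) =
     (\<Prod>k\<in>J. g \<tau> (card {s\<in>S. q s = k}) / 2)"
proof -
  define \<epsilon> :: "bool \<Rightarrow> real" where "\<epsilon> b = (if b then 1 else - 1)" for b
  have ev: "(\<Prod>k\<in>J. (1 + (- 1 :: real) ^ a k) / 2) = (if \<forall>k\<in>J. even (a k) then 1 else 0)" for a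
  proof (cases "\<forall>k\<in>J. even (a k)")
    case False
    then obtain k where "k \<in> J" "odd (a k)" by blast
    then show ?thesis using False fin(2) by (auto intro!: prod_zero bexI[of _ k])
  qed simp
  have "(\<Prod>k\<in>J. g \<tau> (card {s\<in>S. q s = k}) / 2) =
      (\<Prod>k\<in>J. (1 + \<epsilon> True * \<tau>) ^ card {s\<in>S. q s = k} / 2 + (1 + \<epsilon> False * \<tau>) ^ card {s\<in>S. q s = k} / 2)"
    by (simp add: g_def \<epsilon>_def add_divide_distrib)
  also have "\<dots> = (\<Sum>U\<in>Pow J. \<Prod>k\<in>J. (1 + \<epsilon> (k \<in> U) * \<tau>) ^ card {s\<in>S. q s = k} / 2)"
    by (rule prod_add_Pow[OF fin(2), of "\<lambda>b k. (1 + \<epsilon> b * \<tau>) ^ card {s\<in>S. q s = k} / 2"])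
  also have "\<dots> = (\<Sum>U\<in>Pow J. \<Sum>K\<in>Pow S. (\<Prod>k\<in>J. \<epsilon> (k \<in> U) ^ card {s\<in>K. q s = k} / 2) * \<tau> ^ card K)"
  proof (rule sum.cong[OF refl])
    fix U
    have "(\<Prod>k\<in>J. (1 + \<epsilon> (k \<in> U) * \<tau>) ^ card {s\<in>S. q s = k}) = (\<Prod>s\<in>S. \<epsilon> (q s \<in> U) * \<tau> + 1)"
      using prod_fibres[OF fin q, of "\<lambda>k. 1 + \<epsilon> (k \<in> U) * \<tau>"] by (simp add: add.commute)
    also have "\<dots> = (\<Sum>K\<in>Pow S. \<Prod>s\<in>K. \<epsilon> (q s \<in> U) * \<tau>)"
      by (subst prod_add[OF fin(1)]) simp
    also have "\<dots> = (\<Sum>K\<in>Pow S. (\<Prod>k\<in>J. \<epsilon> (k \<in> U) ^ card {s\<in>K. q s = k}) * \<tau> ^ card K)"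
    proof (rule sum.cong[OF refl])
      fix K assume "K \<in> Pow S"
      then have "(\<Prod>s\<in>K. \<epsilon> (q s \<in> U)) = (\<Prod>k\<in>J. \<epsilon> (k \<in> U) ^ card {s\<in>K. q s = k})"
        using fin q by (intro prod_fibres) (auto intro: finite_subset)
      then show "(\<Prod>s\<in>K. \<epsilon> (q s \<in> U) * \<tau>) = (\<Prod>k\<in>J. \<epsilon> (k \<in> U) ^ card {s\<in>K. q s = k}) * \<tau> ^ card K"
        by (simp add: prod.distrib)
    qed
    finally show "(\<Prod>k\<in>J. (1 + \<epsilon> (k \<in> U) * \<tau>) ^ card {s\<in>S. q s = k} / 2) =
       (\<Sum>K\<in>Pow S. (\<Prod>k\<in>J. \<epsilon> (k \<in> U) ^ card {s\<in>K. q s = k} / 2) * \<tau> ^ card K)"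
      by (simp add: prod_dividef sum_divide_distrib)
  qed
  also have "\<dots> = (\<Sum>K\<in>Pow S. (\<Sum>U\<in>Pow J. \<Prod>k\<in>J. \<epsilon> (k \<in> U) ^ card {s\<in>K. q s = k} / 2) * \<tau> ^ card K)"
    by (subst sum.swap) (simp add: sum_distrib_right)
  also have "\<dots> = (\<Sum>K\<in>Pow S. (if \<forall>k\<in>J. even (card {s\<in>K. q s = k}) then \<tau> ^ card K else 0))"
  proof (rule sum.cong[OF refl])
    fix K
    have "(\<Sum>U\<in>Pow J. \<Prod>k\<in>J. \<epsilon> (k \<in> U) ^ card {s\<in>K. q s = k} / 2) =
        (\<Prod>k\<in>J. \<epsilon> True ^ card {s\<in>K. q s = k} / 2 + \<epsilon> False ^ card {s\<in>K. q s = k} / 2)"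
      by (rule prod_add_Pow[OF fin(2), of "\<lambda>b k. \<epsilon> b ^ card {s\<in>K. q s = k} / 2", symmetric])
    also have "\<dots> = (\<Prod>k\<in>J. (1 + (- 1) ^ card {s\<in>K. q s = k}) / 2)"
      by (simp add: \<epsilon>_def add_divide_distrib)
    finally show "(\<Sum>U\<in>Pow J. \<Prod>k\<in>J. \<epsilon> (k \<in> U) ^ card {s\<in>K. q s = k} / 2) * \<tau> ^ card K =
       (if \<forall>k\<in>J. even (card {s\<in>K. q s = k}) then \<tau> ^ card K else 0)"
      by (simp only: ev) simp
  qed
  also have "\<dots> = (\<Sum>K | K \<subseteq> S \<and> (\<forall>k\<in>J. even (card {s\<in>K. q s = k})). \<tau> ^ card K)"
    using fin by (subst sum.inter_filter[symmetric]) (auto intro!: sum.cong)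
  finally show ?thesis by simp
qed

text \<open>One coefficient of a generating function with nonnegative terms is at most the whole
  value divided by \<open>\<tau> ^ w\<close>.\<close>

lemma card_even_subsets_le:
  fixes \<tau> :: real
  assumes fin: "finite S" "finite J" and q: "q ` S \<subseteq> J" and "\<tau> > 0"
  shows "real (card {K. K \<subseteq> S \<and> card K = w \<and> (\<forall>k\<in>J. even (card {s\<in>K. q s = k}))}) * \<tau> ^ w
     \<le> (\<Prod>k\<in>J. g \<tau> (card {s\<in>S. q s = k}) / 2)"
proof -
  let ?X = "{K. K \<subseteq> S \<and> card K = w \<and> (\<forall>k\<in>J. even (card {s\<in>K. q s = k}))}"
  have "real (card ?X) * \<tau> ^ w = (\<Sum>K\<in>?X. \<tau> ^ card K)" by simp
  also have "\<dots> \<le> (\<Sum>K | K \<subseteq> S \<and> (\<forall>k\<in>J. even (card {s\<in>K. q s = k})). \<tau> ^ card K)"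
    using fin \<open>\<tau> > 0\<close> by (intro sum_mono2) auto
  finally show ?thesis by (simp add: even_generating_function[OF fin q])
qed

lemma bij_extending_equal_card:
  assumes "finite S" "K \<subseteq> S" "K' \<subseteq> S" "card K = card K'"
  obtains \<pi> where "bij_betw \<pi> S S" "bij_betw \<pi> K K'"
proof -
  have fin: "finite K" "finite K'" using assms by (auto intro: finite_subset)
  obtain a where a: "bij_betw a K K'"
    using finite_same_card_bij[OF fin assms(4)] by blast
  have "card (S - K) = card (S - K')" using assms fin by (simp add: card_Diff_subset)
  then obtain b where b: "bij_betw b (S - K) (S - K')"
    using finite_same_card_bij[of "S - K" "S - K'"] assms by auto
  define \<pi> where "\<pi> s = (if s \<in> K then a s else b s)" for s
  have "bij_betw \<pi> K K'" using a by (rule bij_betw_cong[THEN iffD1, rotated]) (simp add: \<pi>_def)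
  moreover have "bij_betw \<pi> (S - K) (S - K')"
    using b by (rule bij_betw_cong[THEN iffD1, rotated]) (simp add: \<pi>_def)
  ultimately have "bij_betw \<pi> (K \<union> (S - K)) (K' \<union> (S - K'))"
    by (rule bij_betw_combine) auto
  moreover have "K \<union> (S - K) = S" "K' \<union> (S - K') = S" using assms by auto
  ultimately show ?thesis using that \<open>bij_betw \<pi> K K'\<close> by simp
qed

lemma card_filter_bij:
  assumes "bij_betw \<pi> K K'"
  shows "card {s\<in>K. P (\<pi> s)} = card {s\<in>K'. P s}"
proof -
  have "bij_betw \<pi> {s\<in>K. P (\<pi> s)} {s\<in>K'. P s}"
    using assms unfolding bij_betw_def by (auto simp: inj_on_def)
  then show ?thesis by (rule bij_betw_same_card)
qed

lemma card_filter_sum: "finite A \<Longrightarrow> card {x\<in>A. P x} = (\<Sum>x\<in>A. if P x then 1 else 0)"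
  by (simp add: sum.If_cases Int_def)

definition parity_assignments ::
  "'a set \<Rightarrow> 'b set \<Rightarrow> ('b \<Rightarrow> nat) \<Rightarrow> 'k set \<Rightarrow> ('b \<Rightarrow> 'k) \<Rightarrow> 'a set \<Rightarrow> ('a \<Rightarrow> 'b) set" where
  "parity_assignments S I d J blk K =
     {f \<in> assignments S I d. \<forall>k\<in>J. even (card {s\<in>K. blk (f s) = k})}"

text \<open>Composing with a permutation of \<open>S\<close> that carries \<open>K\<close> to
  \<open>K'\<close> preserves all value counts and moves the parity condition from \<open>K'\<close>
  to \<open>K\<close>. Restricting to \<open>S\<close> keeps the result extensional.\<close>

lemma card_parity_assignments_le:
  assumes fin: "finite S" "finite I" and K: "K \<subseteq> S" "K' \<subseteq> S" "card K = card K'"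
  shows "card (parity_assignments S I d J blk K') \<le> card (parity_assignments S I d J blk K)"
proof -
  obtain \<pi> where \<pi>: "bij_betw \<pi> S S" "bij_betw \<pi> K K'"
    using bij_extending_equal_card[OF fin(1) K] .
  define h where "h f = restrict (f \<circ> \<pi>) S" for f :: "'a \<Rightarrow> 'b"
  have \<pi>S: "\<pi> s \<in> S" if "s \<in> S" for s using \<pi>(1) that by (auto simp: bij_betw_def)
  have "inj_on h (assignments S I d)"
  proof (rule inj_onI)
    fix f f' assume f: "f \<in> assignments S I d" "f' \<in> assignments S I d" and eq: "h f = h f'"
    have "f s = f' s" if s: "s \<in> S" for s
    proof -
      obtain u where u: "u \<in> S" "s = \<pi> u" using \<pi>(1) s by (auto simp: bij_betw_def)
      then show ?thesis using fun_cong[OF eq, of u] by (simp add: h_def)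
    qed
    then show "f = f'" using f by (intro PiE_ext[of f S "\<lambda>_. I" f']) (auto simp: assignments_def)
  qed
  then have "inj_on h (parity_assignments S I d J blk K')"
    by (rule inj_on_subset) (auto simp: parity_assignments_def)
  moreover have "h ` parity_assignments S I d J blk K' \<subseteq> parity_assignments S I d J blk K"
  proof (rule image_subsetI)
    fix f assume f: "f \<in> parity_assignments S I d J blk K'"
    have "card {s\<in>S. h f s = i} = card {s\<in>S. f s = i}" for i
      using card_filter_bij[OF \<pi>(1), of "\<lambda>s. f s = i"] by (simp add: h_def cong: conj_cong)
    moreover have "{s\<in>K. blk (h f s) = k} = {s\<in>K. blk (f (\<pi> s)) = k}" for k
      using K by (auto simp: h_def)
    then have "card {s\<in>K. blk (h f s) = k} = card {s\<in>K'. blk (f s) = k}" for k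
      using card_filter_bij[OF \<pi>(2), of "\<lambda>s. blk (f s) = k"] by simp
    moreover have "h f \<in> S \<rightarrow>\<^sub>E I"
      using f \<pi>S by (auto simp: h_def parity_assignments_def assignments_def)
    ultimately show "h f \<in> parity_assignments S I d J blk K"
      using f by (auto simp: parity_assignments_def assignments_def)
  qed
  moreover have "finite (parity_assignments S I d J blk K)"
    using finite_assignments[OF fin] by (simp add: parity_assignments_def)
  ultimately show ?thesis by (rule card_inj_on_le)
qed

text \<open>By symmetry the number of parity-respecting assignments depends on \<open>K\<close> only through its
  size, so it can be computed by averaging over all \<open>K\<close> of that size.\<close>

lemma parity_assignments_bound:
  fixes \<tau> :: real
  assumes fin: "finite S" "finite I" "finite J" and blk: "blk ` I \<subseteq> J" and K: "K \<subseteq> S"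
    and \<tau>: "\<tau> > 0"
  shows "real (card (parity_assignments S I d J blk K)) * real (card S choose card K) * \<tau> ^ card K
     \<le> real (card (assignments S I d)) * (\<Prod>k\<in>J. g \<tau> (\<Sum>i | i \<in> I \<and> blk i = k. d i) / 2)"
proof -
  let ?F = "assignments S I d" and ?N = "{K'. K' \<subseteq> S \<and> card K' = card K}"
  let ?M = "\<lambda>K' f. \<forall>k\<in>J. even (card {s\<in>K'. blk (f s) = k})"
  let ?Q = "\<Prod>k\<in>J. g \<tau> (\<Sum>i | i \<in> I \<and> blk i = k. d i) / 2"
  have finF: "finite ?F" and finN: "finite ?N" using fin by (auto intro: finite_assignments)
  have "card (parity_assignments S I d J blk K) * (card S choose card K)
      = (\<Sum>K'\<in>?N. card (parity_assignments S I d J blk K))"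
    using n_subsets[OF fin(1), of "card K"] by simp
  also have "\<dots> \<le> (\<Sum>K'\<in>?N. card (parity_assignments S I d J blk K'))"
    using K fin by (intro sum_mono card_parity_assignments_le) auto
  also have "\<dots> = (\<Sum>K'\<in>?N. \<Sum>f\<in>?F. if ?M K' f then 1 else 0)"
    unfolding parity_assignments_def using finF by (intro sum.cong refl card_filter_sum)
  also have "\<dots> = (\<Sum>f\<in>?F. \<Sum>K'\<in>?N. if ?M K' f then 1 else 0)"
    by (rule sum.swap)
  also have "\<dots> = (\<Sum>f\<in>?F. card {K'\<in>?N. ?M K' f})"
    using finN by (intro sum.cong refl card_filter_sum[symmetric])
  finally have "real (card (parity_assignments S I d J blk K) * (card S choose card K)) * \<tau> ^ card K
      \<le> real (\<Sum>f\<in>?F. card {K'\<in>?N. ?M K' f}) * \<tau> ^ card K"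
    using \<tau> by (intro mult_right_mono of_nat_mono) auto
  also have "\<dots> = (\<Sum>f\<in>?F. real (card {K'\<in>?N. ?M K' f}) * \<tau> ^ card K)"
    by (simp add: sum_distrib_right)
  also have "\<dots> \<le> (\<Sum>f\<in>?F. ?Q)"
  proof (rule sum_mono)
    fix f assume f: "f \<in> ?F"
    have fI: "f s \<in> I" if "s \<in> S" for s using f that by (auto simp: assignments_def)
    \<comment> \<open>The block sizes seen from the sockets are fixed by the prescribed counts, so
      the generating function is the same for every assignment.\<close>
    have d: "card {s\<in>S. blk (f s) = k} = (\<Sum>i | i \<in> I \<and> blk i = k. d i)" for k
    proof -
      have "{s\<in>S. blk (f s) = k} = (\<Union>i\<in>{i\<in>I. blk i = k}. {s\<in>S. f s = i})"
        using fI by auto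
      then have "card {s\<in>S. blk (f s) = k} = (\<Sum>i | i \<in> I \<and> blk i = k. card {s\<in>S. f s = i})"
        using fin by (simp only:) (rule card_UN_disjoint, auto)
      then show ?thesis using f by (simp add: assignments_def)
    qed
    have "real (card {K'\<in>?N. ?M K' f}) * \<tau> ^ card K \<le> (\<Prod>k\<in>J. g \<tau> (card {s\<in>S. blk (f s) = k}) / 2)"
      using card_even_subsets_le[OF fin(1,3) _ \<tau>, of "\<lambda>s. blk (f s)" "card K"] fI blk
      by (simp add: image_subset_iff conj_assoc)
    then show "real (card {K'\<in>?N. ?M K' f}) * \<tau> ^ card K \<le> ?Q" by (simp add: d)
  qed
  finally show ?thesis by simp
qed

section \<open>A lower bound for binomial coefficients\<close>

lemma ln_fact_bounds:
  assumes "n \<ge> 1"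
  shows "ln (fact n) \<le> (real n + 1/2) * ln (real n) - real n + 1"
    and "ln (fact n) \<ge> (real n + 1/2) * ln (real n) - real n + 3/4"
proof -
  define s where "s n = ln (fact n) - (real n + 1/2) * ln (real n) + real n" for n :: nat
  \<comment> \<open>Stirling's sequence decreases. By the trapezoidal bound for the logarithm each
    decrease is at most \<open>1/(4*n) - 1/(4*(n+1))\<close>, which telescopes; hence the
    strengthened lower bound, with equality at \<open>n = 1\<close>.\<close>
  have "s n \<le> 1 \<and> s n \<ge> 3/4 + 1 / (4 * real n)"
    using assms
  proof (induction n rule: dec_induct)
    case base
    show ?case by (simp add: s_def)
  next
    case (step n)
    define d where "d = ln (real n + 1) - ln (real n)"
    have n: "real n > 0" using step.hyps by simp
    have diff: "s n - s (Suc n) = (real n + 1/2) * d - 1"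
    proof -
      have "ln (fact (Suc n) :: real) = ln ((real n + 1) * fact n)" by (simp add: algebra_simps)
      also have "\<dots> = ln (real n + 1) + ln (fact n)" using n by (intro ln_mult_pos) auto
      finally show ?thesis by (simp add: s_def d_def algebra_simps del: fact_Suc)
    qed
    have "(real n + 1/2) * (2 / (2 * real n + 1)) \<le> (real n + 1/2) * d"
      using ln_inverse_approx_ge[of "real n" "real n + 1"] n
      by (intro mult_left_mono) (auto simp: d_def algebra_simps)
    then have lo: "1 \<le> (real n + 1/2) * d" using n by (simp add: field_simps)
    have "(real n + 1/2) * d \<le> (real n + 1/2) * ((inverse (real n) + inverse (real n + 1)) / 2)"
      using ln_inverse_approx_le[of "real n" 1] n by (intro mult_left_mono) (auto simp: d_def)
    also have "\<dots> = 1 + (1 / (4 * real n) - 1 / (4 * real (Suc n)))"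
      using n by (simp add: divide_simps) (simp add: algebra_simps)
    finally show ?case using step.IH lo diff by linarith
  qed
  moreover have "0 \<le> 1 / (4 * real n)" by simp
  ultimately have "s n \<le> 1" "s n \<ge> 3/4" by linarith+
  then show "ln (fact n) \<le> (real n + 1/2) * ln (real n) - real n + 1"
    "ln (fact n) \<ge> (real n + 1/2) * ln (real n) - real n + 3/4"
    by (simp_all add: s_def)
qed

text \<open>The constant 5/4 is \<open>1 + 1 - 3/4\<close>, from two upper bounds and one lower
  bound for factorials.\<close>

lemma ln_binomial_ge:
  assumes "0 < w" "w \<le> m"
  shows "ln (real (m choose w)) \<ge>
    real m * He (real w / real m) - 1/2 * ln (real w * (1 - real w / real m)) - 5/4"
proof (cases "w = m")
  case True
  \<comment> \<open>Here \<open>ln 0 = 0\<close> makes both the entropy and the Stirling term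
    vanish, and the claim is \<open>0 \<ge> - 5/4\<close>.\<close>
  then show ?thesis using assms by (simp add: He_def)
next
  case False
  define v where "v = m - w"
  have pos: "real m > 0" "real w > 0" "real v > 0" and m: "real m = real w + real v"
    using assms False by (auto simp: v_def of_nat_diff)
  have "real (m choose w) = fact m / (fact w * fact v)"
    using binomial_fact[of w m, where 'a = real] assms by (simp add: v_def)
  then have "ln (real (m choose w)) = ln (fact m) - ln (fact w) - ln (fact v)"
    by (simp add: ln_div ln_mult)
  also have "\<dots> \<ge> ((real m + 1/2) * ln (real m) - real m + 3/4)
      - ((real w + 1/2) * ln (real w) - real w + 1) - ((real v + 1/2) * ln (real v) - real v + 1)"
    using pos by (intro diff_mono ln_fact_bounds) auto
  finally have 1: "ln (real (m choose w)) \<ge> real m * ln (real m) - real w * ln (real w) - real v * ln (real v)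
     + 1/2 * (ln (real m) - ln (real w) - ln (real v)) - 5/4"
    using m by (simp add: algebra_simps)
  have v: "1 - real w / real m = real v / real m" using pos m by (simp add: field_simps)
  have "real m * He (real w / real m) = - real w * ln (real w / real m) - real v * ln (real v / real m)"
    using pos by (simp add: He_def v right_diff_distrib)
  also have "\<dots> = real m * ln (real m) - real w * ln (real w) - real v * ln (real v)"
    using pos m by (simp add: ln_div algebra_simps)
  finally have 2: "real m * He (real w / real m) = \<dots>" .
  have "ln (real w * (1 - real w / real m)) = ln (real w) + ln (real v) - ln (real m)"
    using pos by (simp add: v ln_div ln_mult)
  then show ?thesis using 1 2 by (simp add: field_simps)
qed

section \<open>Blocks of accumulated rows\<close>

text \<open>Hoelder's inequality for \<open>card B\<close> vectors with two entries. After division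
  by the right-hand side, the arithmetic-geometric mean inequality bounds each of the two products,
  and the two arithmetic means add up to 1.\<close>

lemma prod_plus_prod_le:
  fixes p q :: "'a \<Rightarrow> real"
  assumes "finite B" "B \<noteq> {}" and pos: "\<And>r. r \<in> B \<Longrightarrow> p r > 0" "\<And>r. r \<in> B \<Longrightarrow> q r \<ge> 0"
  defines "s \<equiv> card B"
  shows "(\<Prod>r\<in>B. p r) + (\<Prod>r\<in>B. q r) \<le> (\<Prod>r\<in>B. (p r ^ s + q r ^ s) powr (1 / real s))"
proof -
  define N where "N r = p r ^ s + q r ^ s" for r
  have s: "s > 0" using assms by (simp add: s_def card_gt_0_iff)
  have N: "N r > 0" if "r \<in> B" for r
    using pos[OF that] by (simp add: N_def add_pos_nonneg)
  have root: "(x ^ s) powr (1 / real s) = x" if "x \<ge> 0" for x :: real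
    using that s by (cases "x = 0") (simp_all add: powr_realpow[symmetric] powr_powr)
  have AG: "(\<Prod>r\<in>B. y r) / (\<Prod>r\<in>B. N r powr (1 / real s)) \<le> (\<Sum>r\<in>B. y r ^ s / N r) / real s"
    if y: "\<And>r. r \<in> B \<Longrightarrow> y r \<ge> 0" for y
  proof -
    have nn: "y r ^ s / N r \<ge> 0" if "r \<in> B" for r
      using y[OF that] N[OF that] by simp
    have "(\<Prod>r\<in>B. y r) / (\<Prod>r\<in>B. N r powr (1 / real s)) = (\<Prod>r\<in>B. (y r ^ s / N r) powr (1 / real s))"
      unfolding prod_dividef[symmetric]
    proof (rule prod.cong[OF refl])
      fix r assume r: "r \<in> B"
      show "y r / N r powr (1 / real s) = (y r ^ s / N r) powr (1 / real s)"
        using y[OF r] N[OF r] by (simp add: powr_divide root)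
    qed
    also have "\<dots> = (\<Prod>r\<in>B. y r ^ s / N r) powr (1 / real s)"
      using nn by (subst prod_powr_distrib) simp_all
    also have "\<dots> \<le> (\<Sum>r\<in>B. (y r ^ s / N r) / real s)"
      using arith_geom_mean[OF assms(1,2), of "\<lambda>r. y r ^ s / N r"] y N by (auto simp: less_imp_le s_def)
    finally show ?thesis by (simp add: sum_divide_distrib)
  qed
  let ?P = "\<Prod>r\<in>B. N r powr (1 / real s)"
  have P: "?P > 0"
  proof (rule prod_pos)
    show "N r powr (1 / real s) > 0" if "r \<in> B" for r using N[OF that] by simp
  qed
  have "((\<Prod>r\<in>B. p r) + (\<Prod>r\<in>B. q r)) / ?P \<le> (\<Sum>r\<in>B. p r ^ s / N r) / real s + (\<Sum>r\<in>B. q r ^ s / N r) / real s"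
    unfolding add_divide_distrib using pos by (intro add_mono AG) (auto simp: less_imp_le)
  also have "\<dots> = (\<Sum>r\<in>B. (p r ^ s + q r ^ s) / N r) / real s"
    by (simp add: add_divide_distrib sum.distrib)
  also have "(\<Sum>r\<in>B. (p r ^ s + q r ^ s) / N r) = (\<Sum>r\<in>B. 1)"
  proof (rule sum.cong[OF refl])
    fix r assume "r \<in> B"
    then show "(p r ^ s + q r ^ s) / N r = 1" using N[of r] by (simp add: N_def)
  qed
  also have "\<dots> / real s = 1" using s by (simp add: s_def)
  finally show ?thesis using P by (simp add: N_def)
qed

text \<open>Splits the factor of a block into one factor per row. Hoelder requires nonnegative
  terms, hence the absolute value of \<open>1 - \<tau>\<close>; raising to the even power
  \<open>card B\<close> removes it again. A one-row block needs no splitting. The denominator 2 is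
  shared out as \<open>2 powr (1 / card B)\<close> per row.\<close>

lemma g_sum_le:
  assumes "finite B" "card B = 1 \<or> even (card B) \<and> card B > 0" and \<tau>: "\<tau> > 0"
  shows "g \<tau> (\<Sum>r\<in>B. d r) / 2 \<le> (\<Prod>r\<in>B. (g \<tau> (card B * d r) / 2) powr (1 / real (card B)))"
proof (cases "card B = 1")
  case True
  then obtain r where "B = {r}" by (auto simp: card_1_singleton_iff)
  then show ?thesis using g_pos[OF less_imp_le[OF \<tau>], of "d r"] by simp
next
  case False
  define s where "s = card B"
  have s: "even s" "s > 0" "B \<noteq> {}" using assms(2) False by (auto simp: s_def)
  have "(1 - \<tau>) ^ (\<Sum>r\<in>B. d r) \<le> \<bar>1 - \<tau>\<bar> ^ (\<Sum>r\<in>B. d r)" by (metis abs_ge_self power_abs)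
  then have "g \<tau> (\<Sum>r\<in>B. d r) \<le> (\<Prod>r\<in>B. (1 + \<tau>) ^ d r) + (\<Prod>r\<in>B. \<bar>1 - \<tau>\<bar> ^ d r)"
    by (simp add: g_def power_sum)
  also have "\<dots> \<le> (\<Prod>r\<in>B. (((1 + \<tau>) ^ d r) ^ s + (\<bar>1 - \<tau>\<bar> ^ d r) ^ s) powr (1 / real s))"
    unfolding s_def using assms(1) s \<tau> by (intro prod_plus_prod_le) auto
  also have "\<dots> = (\<Prod>r\<in>B. g \<tau> (s * d r) powr (1 / real s))"
  proof (rule prod.cong[OF refl])
    fix r
    have "(\<bar>1 - \<tau>\<bar> ^ d r) ^ s = (1 - \<tau>) ^ (s * d r)"
      using s(1) by (metis mult.commute power_abs power_even_abs power_mult)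
    then show "(((1 + \<tau>) ^ d r) ^ s + (\<bar>1 - \<tau>\<bar> ^ d r) ^ s) powr (1 / real s) = g \<tau> (s * d r) powr (1 / real s)"
      by (simp add: g_def power_mult[symmetric] mult.commute)
  qed
  finally have "g \<tau> (\<Sum>r\<in>B. d r) / 2 \<le> (\<Prod>r\<in>B. g \<tau> (s * d r) powr (1 / real s)) / 2" by simp
  also have "(\<Prod>r\<in>B. g \<tau> (s * d r) powr (1 / real s)) / 2 =
      (\<Prod>r\<in>B. g \<tau> (s * d r) powr (1 / real s)) / (\<Prod>r\<in>B. 2 powr (1 / real s))"
    using s by (simp add: s_def powr_realpow[symmetric] powr_powr)
  also have "(\<Prod>r\<in>B. g \<tau> (s * d r) powr (1 / real s)) / (\<Prod>r\<in>B. 2 powr (1 / real s))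
     = (\<Prod>r\<in>B. (g \<tau> (s * d r) / 2) powr (1 / real s))"
    unfolding prod_dividef[symmetric] using g_pos[OF less_imp_le[OF \<tau>]] by (simp add: powr_divide less_imp_le)
  finally show ?thesis unfolding s_def .
qed

text \<open>The block containing a row, with rows and blocks numbered from 0: the first \<open>small_blocks i\<close>
  blocks have size \<open>2 ^ (T - clog i)\<close>, the others have twice that size.\<close>

definition small_blocks :: "nat \<Rightarrow> nat" where
  "small_blocks i = (if i = 2 ^ flog i then i else 2 * (i - 2 ^ flog i))"

definition small_rows :: "nat \<Rightarrow> nat \<Rightarrow> nat" where
  "small_rows T i = small_blocks i * 2 ^ (T - clog i)"

definition block_of :: "nat \<Rightarrow> nat \<Rightarrow> nat \<Rightarrow> nat" where
  "block_of T i r = (if r < small_rows T i then r div 2 ^ (T - clog i)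
     else small_blocks i + (r - small_rows T i) div (2 * 2 ^ (T - clog i)))"

lemma flog_le: "i \<ge> 1 \<Longrightarrow> 2 ^ flog i \<le> i"
  and less_flog: "i \<ge> 1 \<Longrightarrow> i < 2 ^ Suc (flog i)"
proof -
  assume i: "i \<ge> 1"
  have "real (flog i) = of_int \<lfloor>log 2 (real i)\<rfloor>" using i by (simp add: flog_def)
  then have "real (flog i) \<le> log 2 (real i)" "log 2 (real i) < real (flog i) + 1" by linarith+
  then have "2 powr real (flog i) \<le> real i" "real i < 2 powr (real (flog i) + 1)"
    using i by (simp_all add: le_log_iff log_less_iff)
  then have "real (2 ^ flog i) \<le> real i" "real i < real (2 ^ Suc (flog i))"
    by (simp_all add: powr_realpow powr_add)
  then show "2 ^ flog i \<le> i" "i < 2 ^ Suc (flog i)" by (simp_all only: of_nat_le_iff of_nat_less_iff)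
qed

lemma clog_eq:
  assumes i: "i \<ge> 1"
  shows "clog i = (if i = 2 ^ flog i then flog i else Suc (flog i))"
proof (cases "i = 2 ^ flog i")
  case True
  have "log 2 (real i) = real (flog i)" by (subst True) (simp add: log_nat_power)
  then show ?thesis using True by (simp add: clog_def)
next
  case False
  then have "2 ^ flog i < i" using flog_le[OF i] by simp
  then have "real (2 ^ flog i) < real i" "real i < real (2 ^ Suc (flog i))"
    using less_flog[OF i] by (simp_all only: of_nat_less_iff)
  then have "2 powr real (flog i) < real i" "real i < 2 powr (real (flog i) + 1)"
    by (simp_all add: powr_realpow powr_add)
  then have "real (flog i) < log 2 (real i)" "log 2 (real i) < real (flog i) + 1"
    using i by (simp_all add: less_log_iff log_less_iff)
  then have "\<lceil>log 2 (real i)\<rceil> = int (flog i) + 1" by linarith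
  then show ?thesis using False by (simp add: clog_def nat_add_distrib)
qed

lemma clog_le:
  assumes "1 \<le> i" "i \<le> 2 ^ T"
  shows "clog i \<le> T"
proof -
  have "log 2 (real i) \<le> log 2 (real (2 ^ T))" using assms by (simp only: log_le_cancel_iff)
  then have "log 2 (real i) \<le> real T" by (simp add: log_nat_power)
  then show ?thesis by (simp add: clog_def ceiling_le_iff)
qed

text \<open>Doubling every small block would add \<open>small_rows T i\<close> rows and give all
  \<open>i\<close> blocks the larger size. The sums are written without subtraction so that they
  stay valid in the natural numbers.\<close>

lemma small_rows_eq:
  assumes "1 \<le> i" "i \<le> 2 ^ T"
  shows "small_rows T i + 2 ^ T = 2 * i * 2 ^ (T - clog i)"
    and "small_rows T i + (i - small_blocks i) * (2 * 2 ^ (T - clog i)) = 2 ^ T"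
    and "small_blocks i \<le> i" "small_rows T i \<le> 2 ^ T"
proof -
  have T: "(2::nat) ^ T = 2 ^ clog i * 2 ^ (T - clog i)"
    using clog_le[OF assms] by (simp add: power_add[symmetric])
  show 1: "small_rows T i + 2 ^ T = 2 * i * 2 ^ (T - clog i)"
  proof (cases "i = 2 ^ flog i")
    case True
    then have "2 ^ clog i = i" using clog_eq[OF assms(1)] by simp
    then show ?thesis unfolding T using True by (simp add: small_rows_def small_blocks_def)
  next
    case False
    have "(2::nat) ^ clog i = 2 * 2 ^ flog i" using clog_eq[OF assms(1)] False by simp
    then have "small_blocks i + 2 ^ clog i = 2 * i"
      using False flog_le[OF assms(1)] by (simp add: small_blocks_def)
    then show ?thesis unfolding T small_rows_def add_mult_distrib[symmetric] by simp
  qed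
  show 3: "small_blocks i \<le> i"
    using less_flog[OF assms(1)] by (auto simp: small_blocks_def)
  have "i * (2 * 2 ^ (T - clog i)) = small_blocks i * (2 * 2 ^ (T - clog i)) + (i - small_blocks i) * (2 * 2 ^ (T - clog i))"
    using 3 by (simp add: add_mult_distrib[symmetric])
  then show "small_rows T i + (i - small_blocks i) * (2 * 2 ^ (T - clog i)) = 2 ^ T"
    using 1 by (simp add: small_rows_def)
  then show "small_rows T i \<le> 2 ^ T" by linarith
qed

lemma block_of_eq_iff_small:
  assumes "k < small_blocks i"
  shows "block_of T i r = k \<longleftrightarrow> r \<in> {k * 2 ^ (T - clog i)..<Suc k * 2 ^ (T - clog i)}"
proof -
  define c :: nat where "c = 2 ^ (T - clog i)"
  have c: "c > 0" by (simp add: c_def)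
  have "Suc k * c \<le> small_blocks i * c" using assms by (intro mult_le_mono1) simp
  then have "r < small_rows T i" if "r < Suc k * c" using that by (simp add: small_rows_def c_def)
  moreover have "r div c = k \<longleftrightarrow> r \<in> {k * c..<Suc k * c}"
    using c by (auto simp: div_nat_eqI dividend_less_times_div mult.commute)
  ultimately show ?thesis using assms by (auto simp: block_of_def c_def[symmetric])
qed

lemma block_of_eq_iff_large:
  assumes "small_blocks i \<le> k"
  shows "block_of T i r = k \<longleftrightarrow>
    r \<in> {small_rows T i + (k - small_blocks i) * (2 * 2 ^ (T - clog i))..<
         small_rows T i + Suc (k - small_blocks i) * (2 * 2 ^ (T - clog i))}"
proof -
  define c :: nat where "c = 2 ^ (T - clog i)"
  have c: "c > 0" by (simp add: c_def)
  have div: "u div (2 * c) = j \<longleftrightarrow> u \<in> {j * (2 * c)..<Suc j * (2 * c)}" for u j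
    using c by (auto simp: div_nat_eqI dividend_less_times_div mult.commute)
  show ?thesis
  proof (cases "r < small_rows T i")
    case True
    then have "r div c < small_blocks i"
      by (simp add: small_rows_def c_def[symmetric] less_mult_imp_div_less)
    then show ?thesis using True assms by (simp add: block_of_def c_def)
  next
    case False
    then obtain u where u: "r = small_rows T i + u" by (metis le_Suc_ex not_less)
    obtain j where j: "k = small_blocks i + j" using assms by (metis le_Suc_ex)
    show ?thesis using div[of u j] by (simp add: block_of_def u j c_def)
  qed
qed

lemma card_block_of:
  assumes i: "1 \<le> i" "i \<le> 2 ^ T" and "k < i"
  shows "card {r. r < 2 ^ T \<and> block_of T i r = k} =
    (if k < small_blocks i then 2 ^ (T - clog i) else 2 * 2 ^ (T - clog i))"
proof (cases "k < small_blocks i")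
  case True
  have "Suc k * 2 ^ (T - clog i) \<le> small_rows T i"
    unfolding small_rows_def using True by (intro mult_le_mono1) simp
  then have "{r. r < 2 ^ T \<and> block_of T i r = k} = {k * 2 ^ (T - clog i)..<Suc k * 2 ^ (T - clog i)}"
    unfolding block_of_eq_iff_small[OF True] using small_rows_eq(4)[OF i] by auto
  then show ?thesis using True by simp
next
  case False
  have "Suc (k - small_blocks i) * (2 * 2 ^ (T - clog i)) \<le> (i - small_blocks i) * (2 * 2 ^ (T - clog i))"
    using \<open>k < i\<close> False by (intro mult_le_mono1) simp
  then have "small_rows T i + Suc (k - small_blocks i) * (2 * 2 ^ (T - clog i)) \<le>
      small_rows T i + (i - small_blocks i) * (2 * 2 ^ (T - clog i))" by (rule add_left_mono)
  also have "\<dots> = 2 ^ T" by (rule small_rows_eq(2)[OF i])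
  finally have le: "small_rows T i + Suc (k - small_blocks i) * (2 * 2 ^ (T - clog i)) \<le> 2 ^ T" .
  define A B where "A = small_rows T i + (k - small_blocks i) * (2 * 2 ^ (T - clog i))"
    and "B = small_rows T i + Suc (k - small_blocks i) * (2 * 2 ^ (T - clog i))"
  have B: "B \<le> 2 ^ T" using le by (simp only: B_def)
  have "{r. r < 2 ^ T \<and> block_of T i r = k} = {A..<B}"
  proof (rule Set.set_eqI)
    fix r
    have "block_of T i r = k \<longleftrightarrow> A \<le> r \<and> r < B"
      using block_of_eq_iff_large[OF leI[OF False], of T r] unfolding A_def B_def atLeastLessThan_iff .
    then show "r \<in> {r. r < 2 ^ T \<and> block_of T i r = k} \<longleftrightarrow> r \<in> {A..<B}"
      unfolding mem_Collect_eq atLeastLessThan_iff using B by linarith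
  qed
  moreover have "B = A + 2 * 2 ^ (T - clog i)"
    by (simp only: A_def B_def mult_Suc add.assoc add.commute)
  ultimately show ?thesis using False by (simp only: card_atLeastLessThan if_False add_diff_cancel_left')
qed

lemma block_of_less:
  assumes i: "1 \<le> i" "i \<le> 2 ^ T" and r: "r < 2 ^ T"
  shows "block_of T i r < i"
proof (cases "r < small_rows T i")
  case True
  then have "r div 2 ^ (T - clog i) < small_blocks i"
    by (simp add: small_rows_def less_mult_imp_div_less)
  then show ?thesis using True small_rows_eq(3)[OF i] by (simp add: block_of_def)
next
  case False
  define Z where "Z = (i - small_blocks i) * (2 * 2 ^ (T - clog i))"
  have "small_rows T i + Z = 2 ^ T" unfolding Z_def by (rule small_rows_eq(2)[OF i])
  then have "r - small_rows T i < Z" using False r by linarith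
  then have "(r - small_rows T i) div (2 * 2 ^ (T - clog i)) < i - small_blocks i"
    unfolding Z_def by (rule less_mult_imp_div_less)
  then show ?thesis using False by (simp add: block_of_def)
qed

lemma block_of_less_small_iff:
  assumes "1 \<le> i" "i \<le> 2 ^ T"
  shows "block_of T i r < small_blocks i \<longleftrightarrow> r < small_rows T i"
  by (auto simp: block_of_def small_rows_def less_mult_imp_div_less)

lemma acc_block_eq:
  assumes i: "1 \<le> i" "i \<le> 2 ^ T" and "k < i"
  shows "acc_block T i (k + 1) = Suc ` {r. r < 2 ^ T \<and> block_of T i r = k}"
proof -
  define c :: nat where "c = 2 ^ (T - clog i)"
  have bl: "{r. r < 2 ^ T \<and> block_of T i r = k} = {r. block_of T i r = k}"
  proof -
    have "r < 2 ^ T" if "block_of T i r = k" for r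
    proof (cases "r < small_rows T i")
      case False
      have *: "(r - small_rows T i) div (2 * c) < i - small_blocks i"
        using that False \<open>k < i\<close> by (simp add: block_of_def c_def)
      define Z where "Z = (i - small_blocks i) * (2 * c)"
      have "r - small_rows T i < Z"
        unfolding Z_def using * by (subst (asm) div_less_iff_less_mult) (simp_all add: c_def)
      moreover have "small_rows T i + Z = 2 ^ T" unfolding Z_def c_def by (rule small_rows_eq(2)[OF i])
      ultimately show ?thesis by linarith
    qed (use small_rows_eq(4)[OF i] in simp)
    then show ?thesis by blast
  qed
  have small: "{r. block_of T i r = j} = {j * c..<Suc j * c}" if "j < small_blocks i" for j
    by (rule Set.set_eqI) (simp only: mem_Collect_eq c_def block_of_eq_iff_small[OF that, of T])
  show ?thesis
  proof (cases "i = 2 ^ flog i")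
    case True
    \<comment> \<open>For a power of two \<open>acc_j i = 1\<close>, so \<open>acc_block\<close>
      always takes its second branch, with size \<open>2 ^ (T - flog i)\<close>. This equals
      \<open>2 ^ (T - clog i)\<close>, and \<open>small_blocks\<close> counts all these blocks as
      small.\<close>
    have p: "2 ^ flog i = i" using True by (rule sym)
    have "clog i = flog i" using clog_eq[OF i(1)] p by simp
    moreover have "acc_j i = 1" using p by (simp add: acc_j_def)
    moreover have "k < small_blocks i" using p \<open>k < i\<close> by (simp add: small_blocks_def)
    ultimately show ?thesis
      unfolding bl using small[of k] by (simp add: acc_block_def c_def image_Suc_atLeastLessThan
        atLeastLessThanSuc_atLeastAtMost add.commute)
  next
    case False
    have clog: "clog i = Suc (flog i)" using clog_eq[OF i(1)] False by simp
    then have "T - flog i = Suc (T - clog i)" using clog_le[OF i] by linarith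
    then have c2: "2 ^ (T - flog i) = 2 * c" by (simp add: c_def)
    have j: "acc_j i = small_blocks i + 1" using False by (simp add: acc_j_def small_blocks_def)
    show ?thesis
    proof (cases "k < small_blocks i")
      case True
      then show ?thesis
        unfolding bl using small[of k] by (simp add: acc_block_def j c_def image_Suc_atLeastLessThan
          atLeastLessThanSuc_atLeastAtMost add.commute)
    next
      case large: False
      then have "k + 1 - acc_j i = k - small_blocks i" by (simp add: j)
      moreover have "{r. block_of T i r = k} = {small_blocks i * c + (k - small_blocks i) * (2 * c)..<
         small_blocks i * c + (k - small_blocks i + 1) * (2 * c)}"
        by (rule Set.set_eqI) (simp only: mem_Collect_eq c_def Suc_eq_plus1 small_rows_def
          block_of_eq_iff_large[OF leI[OF large], of T])
      ultimately show ?thesis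
        unfolding bl using large by (simp add: acc_block_def j c2 c_def[symmetric]
          image_Suc_atLeastLessThan atLeastLessThanSuc_atLeastAtMost)
    qed
  qed
qed

text \<open>After \<open>g_sum_le\<close> the product over blocks regroups into one over rows, in
  which a row enters only through its own degree and the size of its block. Mixed blocks have
  disappeared.\<close>

lemma prod_blocks_le:
  assumes i: "1 \<le> i" "i \<le> 2 ^ T" and \<tau>: "\<tau> > 0"
  defines "s \<equiv> \<lambda>r. if r < small_rows T i then 2 ^ (T - clog i) else 2 * 2 ^ (T - clog i) :: nat"
  shows "(\<Prod>k<i. g \<tau> (\<Sum>r | r \<in> {..<2 ^ T} \<and> block_of T i r = k. d r) / 2)
     \<le> (\<Prod>r<2 ^ T. (g \<tau> (s r * d r) / 2) powr (1 / real (s r)))"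
proof -
  let ?B = "\<lambda>k. {r \<in> {..<2 ^ T}. block_of T i r = k}"
  have "(\<Prod>k<i. g \<tau> (\<Sum>r\<in>?B k. d r) / 2) \<le> (\<Prod>k<i. \<Prod>r\<in>?B k. (g \<tau> (s r * d r) / 2) powr (1 / real (s r)))"
  proof (rule prod_mono, intro conjI)
    fix k assume "k \<in> {..<i}"
    then have card: "card (?B k) = (if k < small_blocks i then 2 ^ (T - clog i) else 2 * 2 ^ (T - clog i))"
      using card_block_of[OF i, of k] by simp
    show "0 \<le> g \<tau> (\<Sum>r\<in>?B k. d r) / 2" using g_pos[OF less_imp_le[OF \<tau>]] by (simp add: less_imp_le)
    have "card (?B k) = 1 \<or> even (card (?B k)) \<and> card (?B k) > 0"
      unfolding card by (cases "T - clog i") auto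
    then have "g \<tau> (\<Sum>r\<in>?B k. d r) / 2 \<le> (\<Prod>r\<in>?B k. (g \<tau> (card (?B k) * d r) / 2) powr (1 / real (card (?B k))))"
      using \<tau> by (intro g_sum_le) auto
    also have "\<dots> = (\<Prod>r\<in>?B k. (g \<tau> (s r * d r) / 2) powr (1 / real (s r)))"
    proof (rule prod.cong[OF refl])
      fix r assume "r \<in> ?B k"
      then have "card (?B k) = s r" using card block_of_less_small_iff[OF i, of r] by (auto simp: s_def)
      then show "(g \<tau> (card (?B k) * d r) / 2) powr (1 / real (card (?B k))) =
          (g \<tau> (s r * d r) / 2) powr (1 / real (s r))" by (simp only:)
    qed
    finally show "g \<tau> (\<Sum>r\<in>?B k. d r) / 2 \<le> (\<Prod>r\<in>?B k. (g \<tau> (s r * d r) / 2) powr (1 / real (s r)))" .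
  qed
  also have "\<dots> = (\<Prod>r<2 ^ T. (g \<tau> (s r * d r) / 2) powr (1 / real (s r)))"
    by (rule prod.group) (auto simp: block_of_less[OF i])
  finally show ?thesis by simp
qed

section \<open>The exponent\<close>

text \<open>Rows in small blocks and rows of the lower degree are both initial segments, so two
  thresholds cut the rows into four classes; truncated subtraction covers both orders of the
  thresholds.\<close>

lemma sum_two_thresholds:
  fixes G :: "bool \<Rightarrow> bool \<Rightarrow> real"
  assumes "Q \<le> n" "a \<le> n"
  shows "(\<Sum>r<n. G (r < Q) (r < a)) =
    real (min Q a) * G True True + real (a - Q) * G False True + real (Q - a) * G True False
      + real (n - max Q a) * G False False"
proof -
  have split: "(\<Sum>r<n. f r) = (\<Sum>r\<in>{0..<p}. f r) + (\<Sum>r\<in>{p..<q}. f r) + (\<Sum>r\<in>{q..<n}. f r)"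
    if "p \<le> q" "q \<le> n" for p q and f :: "nat \<Rightarrow> real"
    using that by (simp add: sum.atLeastLessThan_concat lessThan_atLeast0)
  show ?thesis
  proof (cases "Q \<le> a")
    case True
    have "(\<Sum>r\<in>{0..<Q}. G (r < Q) (r < a)) = (\<Sum>r\<in>{0..<Q}. G True True)"
      "(\<Sum>r\<in>{Q..<a}. G (r < Q) (r < a)) = (\<Sum>r\<in>{Q..<a}. G False True)"
      "(\<Sum>r\<in>{a..<n}. G (r < Q) (r < a)) = (\<Sum>r\<in>{a..<n}. G False False)"
      using True by (auto intro!: sum.cong)
    then show ?thesis using split[OF True assms(2), of "\<lambda>r. G (r < Q) (r < a)"] True by simp
  next
    case False
    then have le: "a \<le> Q" by simp
    have "(\<Sum>r\<in>{0..<a}. G (r < Q) (r < a)) = (\<Sum>r\<in>{0..<a}. G True True)"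
      "(\<Sum>r\<in>{a..<Q}. G (r < Q) (r < a)) = (\<Sum>r\<in>{a..<Q}. G True False)"
      "(\<Sum>r\<in>{Q..<n}. G (r < Q) (r < a)) = (\<Sum>r\<in>{Q..<n}. G False False)"
      using le by (auto intro!: sum.cong)
    then show ?thesis using split[OF le assms(1), of "\<lambda>r. G (r < Q) (r < a)"] le by simp
  qed
qed

lemma R1_plus_R2: "R1 lb + R2 lb = 1"
  by (simp add: R1_def R2_def)

lemma R1_pos: "R1 lb > 0" and R1_le_1: "R1 lb \<le> 1"
  unfolding R1_def by linarith+

lemma avg_row_degree:
  assumes "lb \<ge> 0"
  shows "real (r1 lb) * R1 lb + real (r2 lb) * R2 lb = lb"
proof -
  have 1: "real (r1 lb) = of_int \<lfloor>lb\<rfloor>" using assms by (simp add: r1_def)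
  show ?thesis
  proof (cases "of_int \<lfloor>lb\<rfloor> = lb")
    case True
    then have "lb - of_int \<lfloor>lb\<rfloor> = 0" "1 + of_int \<lfloor>lb\<rfloor> - lb = 1" by linarith+
    then show ?thesis using 1 True unfolding R1_def R2_def by (simp only: mult_1_right mult_zero_right add_0_right)
  next
    case False
    then have "\<lceil>lb\<rceil> = \<lfloor>lb\<rfloor> + 1" by (simp add: ceiling_altdef)
    then have "real (r2 lb) = of_int \<lfloor>lb\<rfloor> + 1" using assms by (simp add: r2_def nat_add_distrib)
    then show ?thesis using 1 by (simp add: R1_def R2_def algebra_simps)
  qed
qed

lemma theta_sums:
  "theta1 R lb + 2 * theta2 R lb = R1 lb / real (cfac R)"
  "theta3 R lb + 2 * theta4 R lb = R2 lb / real (cfac R)"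
  by (auto simp: theta1_def theta2_def theta3_def theta4_def min_def max_def field_simps)

lemma theta_degree_sum:
  assumes "lb \<ge> 0"
  shows "real (r1 lb * cfac R) * (theta1 R lb + 2 * theta2 R lb)
     + real (r2 lb * cfac R) * (theta3 R lb + 2 * theta4 R lb) = lb"
proof -
  have "real (cfac R) > 0" by (simp add: cfac_def)
  then show ?thesis using avg_row_degree[OF assms] unfolding theta_sums by simp
qed

lemma cfac_eq:
  assumes "1 \<le> i" "i \<le> 2 ^ T"
  shows "cfac (real i / 2 ^ T) = 2 ^ (T - clog i)"
proof -
  have "log 2 (real i / 2 ^ T) = log 2 (real i) - real T"
    using assms by (simp add: log_divide log_nat_power)
  then have "- \<lceil>log 2 (real i / 2 ^ T)\<rceil> = int T - \<lceil>log 2 (real i)\<rceil>" by linarith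
  moreover have "log 2 (real i) \<ge> 0" using assms by simp
  then have "\<lceil>log 2 (real i)\<rceil> = int (clog i)" by (simp add: clog_def)
  ultimately show ?thesis using clog_le[OF assms] by (simp add: cfac_def nat_diff_distrib)
qed

text \<open>The logarithm of the interpolated product of block factors, divided by the number of
  rows (see \<open>prod_rows_eq\<close>). \<open>Pexp\<close> adds to it the entropy term and
  \<open>- \<xi> * ln \<tau>\<close>.\<close>

definition log_gf :: "real \<Rightarrow> real \<Rightarrow> real \<Rightarrow> real" where
  "log_gf R lb \<tau> =
    theta1 R lb * ln (g \<tau> (r1 lb * cfac R) / 2) + theta2 R lb * ln (g \<tau> (2 * (r1 lb * cfac R)) / 2)
    + theta3 R lb * ln (g \<tau> (r2 lb * cfac R) / 2) + theta4 R lb * ln (g \<tau> (2 * (r2 lb * cfac R)) / 2)"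

context
  fixes T i a :: nat and lb R :: real
  assumes i: "1 \<le> i" "i \<le> 2 ^ T" and a: "real a = R1 lb * 2 ^ T" and R: "R = real i / 2 ^ T"
begin

lemma small_rows_real: "real (small_rows T i) = 2 * real i * real (cfac R) - 2 ^ T"
  using arg_cong[OF small_rows_eq(1)[OF i], of real] by (simp add: R cfac_eq[OF i])

lemma first_rows_le: "a \<le> 2 ^ T"
proof -
  have "real a \<le> 1 * 2 ^ T" unfolding a using R1_le_1 by (intro mult_right_mono) auto
  then have "real a \<le> real (2 ^ T)" by simp
  then show ?thesis by (simp only: of_nat_le_iff)
qed

text \<open>Explains the four weights: each is the fraction of rows with a given degree and a given
  block size, divided by that block size. The division comes from the exponent \<open>1 / s\<close>
  in Hoelder's inequality.\<close>

lemma theta_counts: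
  shows "real (min (small_rows T i) a) = 2 ^ T * theta1 R lb * real (cfac R)"
    and "real (a - small_rows T i) = 2 ^ T * theta2 R lb * (2 * real (cfac R))"
    and "real (small_rows T i - a) = 2 ^ T * theta3 R lb * real (cfac R)"
    and "real (2 ^ T - max (small_rows T i) a) = 2 ^ T * theta4 R lb * (2 * real (cfac R))"
proof -
  have c: "real (cfac R) > 0" by (simp add: cfac_def)
  have n: "(2::real) ^ T > 0" by simp
  have iR: "real i = R * 2 ^ T" by (simp add: R)
  have nn: "2 ^ T * min x y = min (2 ^ T * x) (2 ^ T * y)" "min x y * z = min (x * z) (y * z)"
    "2 ^ T * max x y = max (2 ^ T * x) (2 ^ T * y)" "max x y * z = max (x * z) (y * z)"
    if "z \<ge> 0" for x y z :: real
    using that by (auto simp: min_mult_distrib_left min_mult_distrib_right max_mult_distrib_left max_mult_distrib_right)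
  have z: "real (cfac R) \<ge> 0" "2 * real (cfac R) \<ge> 0" using c by auto
  let ?Q = "real (small_rows T i)"
  have Q: "?Q = (2 * R * real (cfac R) - 1) * 2 ^ T" unfolding small_rows_real iR by (simp add: algebra_simps)
  have R2: "R2 lb = 1 - R1 lb" using R1_plus_R2[of lb] by simp
  have diff: "real (x - y) = max (real x - real y) 0" for x y :: nat by (simp add: max_def of_nat_diff)
  have "2 ^ T * theta1 R lb * real (cfac R) = min ?Q (real a)"
    unfolding theta1_def nn(1)[OF z(1)] nn(2)[OF z(1)] Q a using c
    by (intro arg_cong2[of _ _ _ _ min]) (simp_all add: field_simps)
  then show "real (min (small_rows T i) a) = 2 ^ T * theta1 R lb * real (cfac R)" by (simp add: of_nat_min)
  have "2 ^ T * theta2 R lb * (2 * real (cfac R)) = max (real a - ?Q) 0"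
    unfolding theta2_def nn(3)[OF z(2)] nn(4)[OF z(2)] Q a using c
    by (intro arg_cong2[of _ _ _ _ max]) (simp_all add: field_simps)
  then show "real (a - small_rows T i) = 2 ^ T * theta2 R lb * (2 * real (cfac R))" by (simp only: diff)
  have "2 ^ T * theta3 R lb * real (cfac R) = max (?Q - real a) 0"
    unfolding theta3_def nn(3)[OF z(1)] nn(4)[OF z(1)] Q a R2 using c
    by (intro arg_cong2[of _ _ _ _ max]) (simp_all add: field_simps)
  then show "real (small_rows T i - a) = 2 ^ T * theta3 R lb * real (cfac R)" by (simp only: diff)
  have "2 ^ T * theta4 R lb * (2 * real (cfac R)) = min (2 ^ T - ?Q) (2 ^ T - real a)"
    unfolding theta4_def nn(1)[OF z(2)] nn(2)[OF z(2)] Q a R2 using c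
    by (intro arg_cong2[of _ _ _ _ min]) (simp_all add: field_simps)
  also have "\<dots> = 2 ^ T - max ?Q (real a)" by (simp add: min_def max_def)
  also have "\<dots> = real (2 ^ T - max (small_rows T i) a)"
    using first_rows_le small_rows_eq(4)[OF i] by (simp add: of_nat_diff of_nat_max)
  finally show "real (2 ^ T - max (small_rows T i) a) = 2 ^ T * theta4 R lb * (2 * real (cfac R))" by simp
qed

lemma theta_nonneg: "theta1 R lb \<ge> 0" "theta2 R lb \<ge> 0" "theta3 R lb \<ge> 0" "theta4 R lb \<ge> 0"
proof -
  have c: "real (cfac R) > 0" by (simp add: cfac_def)
  have n: "\<not> (2::real) ^ T \<le> 0" by (simp add: not_le)
  have "0 \<le> 2 ^ T * theta1 R lb * real (cfac R)" "0 \<le> 2 ^ T * theta4 R lb * (2 * real (cfac R))"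
    unfolding theta_counts(1,4)[symmetric] by simp_all
  then show "theta1 R lb \<ge> 0" "theta4 R lb \<ge> 0" using c n by (simp_all add: zero_le_mult_iff del: zero_less_power)
  show "theta2 R lb \<ge> 0" "theta3 R lb \<ge> 0" by (simp_all add: theta2_def theta3_def)
qed

lemma prod_rows_eq:
  assumes \<tau>: "\<tau> > 0"
  defines "s \<equiv> \<lambda>r. if r < small_rows T i then 2 ^ (T - clog i) else 2 * 2 ^ (T - clog i) :: nat"
    and "d \<equiv> \<lambda>r. if real r < R1 lb * 2 ^ T then r1 lb else r2 lb"
  shows "(\<Prod>r<2 ^ T. (g \<tau> (s r * d r) / 2) powr (1 / real (s r))) = exp (2 ^ T * log_gf R lb \<tau>)"
proof -
  define c where "c = cfac R"
  have c: "real c > 0" by (simp add: c_def cfac_def)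
  define S where "S b = (if b then c else 2 * c)" for b
  define D where "D b = (if b then r1 lb else r2 lb)" for b
  define G where "G b b' = ln (g \<tau> (S b * D b') / 2) / real (S b)" for b b'
  have s: "s r = S (r < small_rows T i)" for r by (simp add: s_def S_def c_def R cfac_eq[OF i])
  have d: "d r = D (r < a)" for r unfolding d_def D_def a[symmetric] by simp
  have "(\<Prod>r<2 ^ T. (g \<tau> (s r * d r) / 2) powr (1 / real (s r))) =
      (\<Prod>r<2 ^ T. exp (G (r < small_rows T i) (r < a)))"
  proof (rule prod.cong[OF refl])
    fix r
    have "g \<tau> (s r * d r) \<noteq> 0" using g_pos[of \<tau>] \<tau> by (metis less_imp_le less_irrefl)
    then show "(g \<tau> (s r * d r) / 2) powr (1 / real (s r)) = exp (G (r < small_rows T i) (r < a))"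
      by (simp add: powr_def G_def s d)
  qed
  also have "\<dots> = exp (\<Sum>r<2 ^ T. G (r < small_rows T i) (r < a))" by (simp add: exp_sum)
  also have "(\<Sum>r<2 ^ T. G (r < small_rows T i) (r < a)) = 2 ^ T * log_gf R lb \<tau>"
    unfolding sum_two_thresholds[OF small_rows_eq(4)[OF i] first_rows_le] theta_counts
    using c by (simp add: G_def S_def D_def log_gf_def c_def[symmetric] field_simps)
  finally show ?thesis .
qed

text \<open>By \<open>g_asymp\<close> the factor with index \<open>k\<close> grows like \<tau> to
  the power \<open>k - par k\<close>. By \<open>theta_degree_sum\<close> these exponents, weighted
  with the thetas, add up to \<open>xi_max R lb\<close>; the leading coefficients give the
  limit.\<close>

lemma log_gf_tendsto:
  assumes lb: "lb \<ge> 2"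
  shows "((\<lambda>\<tau>. log_gf R lb \<tau> - xi_max R lb * ln \<tau>) \<longlongrightarrow>
     theta1 R lb * par (r1 lb * cfac R) * ln (real (r1 lb * cfac R))
       + theta3 R lb * par (r2 lb * cfac R) * ln (real (r2 lb * cfac R))) at_top"
proof -
  have k: "r1 lb * cfac R > 0" "r2 lb * cfac R > 0"
    using lb by (auto simp: r1_def r2_def cfac_def)
  define u where "u k \<tau> = ln (g \<tau> k / 2) - (real k - par k) * ln \<tau>" for k \<tau>
  have u: "((\<lambda>\<tau>. u k \<tau>) \<longlongrightarrow> par k * ln (real k)) at_top" if "k > 0" for k
  proof -
    have "((\<lambda>\<tau>. ln (g \<tau> k / (2 * \<tau> ^ (if even k then k else k - 1)))) \<longlongrightarrow> ln (if even k then 1 else real k)) at_top"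
      using that by (intro tendsto_ln g_asymp) auto
    moreover have "ln (g \<tau> k / (2 * \<tau> ^ (if even k then k else k - 1))) = u k \<tau>" if "\<tau> > 0" for \<tau>
    proof -
      have "real (if even k then k else k - 1) = real k - par k"
        using \<open>k > 0\<close> by (auto simp: par_def of_nat_diff)
      then have "ln (\<tau> ^ (if even k then k else k - 1)) = (real k - par k) * ln \<tau>"
        using that by (simp only: ln_realpow)
      moreover have "ln (g \<tau> k / (2 * \<tau> ^ e)) = ln (g \<tau> k / 2) - ln (\<tau> ^ e)" for e
        using that g_pos[of \<tau> k] by (simp add: ln_div ln_mult)
      ultimately show ?thesis by (simp add: u_def)
    qed
    ultimately have "((\<lambda>\<tau>. u k \<tau>) \<longlongrightarrow> ln (if even k then 1 else real k)) at_top"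
      by (elim Lim_transform_eventually) (intro eventually_mono[OF eventually_gt_at_top[of 0]])
    then show ?thesis by (simp add: par_def split: if_splits)
  qed
  have "((\<lambda>\<tau>. theta1 R lb * u (r1 lb * cfac R) \<tau> + theta2 R lb * u (2 * (r1 lb * cfac R)) \<tau>
      + theta3 R lb * u (r2 lb * cfac R) \<tau> + theta4 R lb * u (2 * (r2 lb * cfac R)) \<tau>) \<longlongrightarrow>
     theta1 R lb * (par (r1 lb * cfac R) * ln (real (r1 lb * cfac R)))
      + theta2 R lb * (par (2 * (r1 lb * cfac R)) * ln (real (2 * (r1 lb * cfac R))))
      + theta3 R lb * (par (r2 lb * cfac R) * ln (real (r2 lb * cfac R)))
      + theta4 R lb * (par (2 * (r2 lb * cfac R)) * ln (real (2 * (r2 lb * cfac R))))) at_top"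
    using k by (intro tendsto_add tendsto_mult tendsto_const u) auto
  moreover have "theta1 R lb * u (r1 lb * cfac R) \<tau> + theta2 R lb * u (2 * (r1 lb * cfac R)) \<tau>
      + theta3 R lb * u (r2 lb * cfac R) \<tau> + theta4 R lb * u (2 * (r2 lb * cfac R)) \<tau>
      = log_gf R lb \<tau> - xi_max R lb * ln \<tau>" for \<tau>
  proof -
    define k1 k2 where "k1 = r1 lb * cfac R" and "k2 = r2 lb * cfac R"
    have "lb = real k1 * (theta1 R lb + 2 * theta2 R lb) + real k2 * (theta3 R lb + 2 * theta4 R lb)"
      using theta_degree_sum[of lb R] lb by (simp add: k1_def k2_def)
    then have xi: "xi_max R lb = real k1 * (theta1 R lb + 2 * theta2 R lb) + real k2 * (theta3 R lb + 2 * theta4 R lb)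
       - theta1 R lb * par k1 - theta3 R lb * par k2"
      by (simp add: xi_max_def k1_def k2_def mult.commute)
    have "par (2 * k1) = 0" "par (2 * k2) = 0" by (simp_all add: par_def)
    then show ?thesis
      unfolding log_gf_def u_def k1_def[symmetric] k2_def[symmetric] xi by (simp add: algebra_simps)
  qed
  ultimately show ?thesis by (simp add: par_def mult.assoc)
qed

text \<open>At \<tau> = 0 the left side of \<open>tau_eq\<close> equals \<open>lb\<close>, and at
  infinity it tends to \<open>lb - xi_max R lb\<close>, so \<open>lb - \<xi>\<close> lies strictly
  between them. The assumption \<open>lb \<ge> 2\<close> makes both indices at least 2, where
  \<open>gratio\<close> is strictly decreasing.\<close>

lemma tau_pos:
  assumes lb: "lb \<ge> 2" and \<xi>: "0 < \<xi>" "\<xi> < xi_max R lb"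
  shows "tau R lb \<xi> > 0"
proof -
  define k1 k2 where "k1 = r1 lb * cfac R" and "k2 = r2 lb * cfac R"
  have c: "cfac R \<ge> 1" by (simp add: cfac_def)
  have "r1 lb \<ge> 2" "r2 lb \<ge> 2" using lb by (auto simp: r1_def r2_def le_nat_iff le_floor_iff)
  then have k: "k1 \<ge> 2" "k2 \<ge> 2" using c mult_le_mono[of 2 _ 1 "cfac R"] by (auto simp: k1_def k2_def)
  let ?\<Psi> = "\<lambda>\<tau>. real k1 * theta1 R lb * gratio k1 \<tau> + 2 * real k1 * theta2 R lb * gratio (2 * k1) \<tau> +
       real k2 * theta3 R lb * gratio k2 \<tau> + 2 * real k2 * theta4 R lb * gratio (2 * k2) \<tau>"
  have eq: "tau_eq R lb \<xi> \<tau> \<longleftrightarrow> ?\<Psi> \<tau> = lb - \<xi>" for \<tau>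
    by (simp add: tau_eq_def gratio_def k1_def k2_def Let_def)
  have pos: "theta1 R lb + 2 * theta2 R lb > 0"
    unfolding theta_sums using R1_pos[of lb] c by simp
  have "xi_max R lb = lb - theta1 R lb * par k1 - theta3 R lb * par k2"
    by (simp add: xi_max_def k1_def k2_def mult.commute)
  then have y: "theta1 R lb * par k1 + theta3 R lb * par k2 < lb - \<xi>" using \<xi>(2) by simp
  have "lb - \<xi> < real k1 * (theta1 R lb + 2 * theta2 R lb) + real k2 * (theta3 R lb + 2 * theta4 R lb)"
    using theta_degree_sum[of lb R] lb \<xi>(1) by (simp add: k1_def k2_def)
  note sol = gratio_sum_solution[OF k theta_nonneg pos y this]
  have "tau R lb \<xi> \<ge> 0 \<and> tau_eq R lb \<xi> (tau R lb \<xi>)"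
    unfolding tau_def by (rule theI') (unfold eq, rule sol(1))
  then show ?thesis unfolding eq using sol(2) by blast
qed

text \<open>Here \<open>X\<close> stands for the probability, \<open>D\<close> for the cost of
  passing to assignments and \<open>C\<close> for the correction term; 5/4 is the error in
  \<open>ln_binomial_ge\<close>. The assumption \<open>bound\<close> ranges over all positive \<tau>
  because \<open>Pexp\<close> has a branch where \<tau> is finite and two that arise in the
  limit.\<close>

lemma exponent_bound:
  fixes m w :: nat and X D \<xi> C :: real
  assumes lb: "lb \<ge> 2" and m: "real m = lb * 2 ^ T" and w: "real w = \<xi> * 2 ^ T" "0 < w" "w \<le> m"
    and X: "X \<ge> 0" and D: "D \<ge> 1"
    and bound: "\<And>\<tau>. \<tau> > 0 \<Longrightarrow> X * real (m choose w) * \<tau> ^ w \<le> D * exp (2 ^ T * log_gf R lb \<tau>)"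
    and C: "1 / 2 * ln (real w * (1 - real w / real m)) \<le> C"
  shows "ereal X \<le> eexp (ereal (2 ^ T) * Pexp R lb \<xi> + ereal (C + (ln D + 5/4)))"
proof -
  define q where "q = C + (ln D + 5/4)"
  define h where "h = - lb * He (\<xi> / lb)"
  have n: "(2::real) ^ T > 0" by simp
  have \<xi>: "\<xi> > 0" using w(1,2) n by (metis of_nat_0_less_iff zero_less_mult_pos2)
  have wm: "real w / real m = \<xi> / lb" unfolding m w(1) by simp
  have B: "real (m choose w) > 0" using w by simp
  have lnB: "- ln (real (m choose w)) \<le> 2 ^ T * h + C + 5/4"
  proof -
    have "real m * He (real w / real m) = - (2 ^ T * h)" unfolding wm by (simp add: h_def m)
    then show ?thesis using ln_binomial_ge[OF w(2,3)] C by linarith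
  qed
  have Xle: "X \<le> exp (2 ^ T * (h - \<xi> * ln \<tau> + log_gf R lb \<tau>) + q)" if \<tau>: "\<tau> > 0" for \<tau>
  proof -
    have "X = X * real (m choose w) * \<tau> ^ w * (exp (- ln (real (m choose w))) * exp (- (real w * ln \<tau>)))"
    proof -
      have "real (m choose w) * exp (- ln (real (m choose w))) = 1" "\<tau> ^ w * exp (- (real w * ln \<tau>)) = 1"
        using B \<tau> less_imp_neq[OF B] less_imp_neq[OF zero_less_power[OF \<tau>, of w]]
        by (simp_all only: exp_minus exp_of_nat_mult exp_ln right_inverse neq_commute[of 0] simp_thms)
      then have "X = X * (real (m choose w) * exp (- ln (real (m choose w)))) * (\<tau> ^ w * exp (- (real w * ln \<tau>)))"
        by (simp only: mult_1_right)
      then show ?thesis by (simp only: mult_ac)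
    qed
    also have "\<dots> \<le> D * exp (2 ^ T * log_gf R lb \<tau>) * (exp (- ln (real (m choose w))) * exp (- (real w * ln \<tau>)))"
      by (intro mult_right_mono bound \<tau>) simp
    also have "\<dots> = exp (ln D + 2 ^ T * log_gf R lb \<tau> - ln (real (m choose w)) - real w * ln \<tau>)"
      using D by (simp add: exp_add exp_diff exp_minus field_simps)
    also have "\<dots> \<le> exp (2 ^ T * (h - \<xi> * ln \<tau> + log_gf R lb \<tau>) + q)"
      using lnB by (simp add: w(1) q_def algebra_simps)
    finally show ?thesis .
  qed
  have eexp: "eexp (ereal (2 ^ T) * ereal p + ereal q) = ereal (exp (2 ^ T * p + q))" for p
    by (simp add: eexp_def)
  define lim where "lim = theta1 R lb * par (r1 lb * cfac R) * ln (real (r1 lb * cfac R))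
       + theta3 R lb * par (r2 lb * cfac R) * ln (real (r2 lb * cfac R))"
  define u where "u \<tau> = log_gf R lb \<tau> - xi_max R lb * ln \<tau>" for \<tau>
  have u: "(u \<longlongrightarrow> lim) at_top"
    using log_gf_tendsto[OF lb] unfolding u_def[abs_def] lim_def .
  \<comment> \<open>After normalizing by the growth of \<open>log_gf\<close>, the power of \<tau>
    that remains has exponent \<open>- 2 ^ T * (\<xi> - xi_max R lb)\<close>. It is constant at
    \<open>\<xi> = xi_max R lb\<close> and tends to 0 beyond, where it forces
    \<open>X = 0\<close>.\<close>
  have Xu: "eventually (\<lambda>\<tau>. X \<le> exp (2 ^ T * (h + u \<tau>) + q) * exp (- (2 ^ T * (\<xi> - xi_max R lb)) * ln \<tau>)) at_top"
  proof (rule eventually_mono[OF eventually_gt_at_top[of 0]])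
    fix \<tau> :: real assume "\<tau> > 0"
    then show "X \<le> exp (2 ^ T * (h + u \<tau>) + q) * exp (- (2 ^ T * (\<xi> - xi_max R lb)) * ln \<tau>)"
      using Xle[of \<tau>] by (simp add: u_def exp_add[symmetric] algebra_simps)
  qed
  have lim1: "((\<lambda>\<tau>. exp (2 ^ T * (h + u \<tau>) + q)) \<longlongrightarrow> exp (2 ^ T * (h + lim) + q)) at_top"
    by (intro tendsto_intros u)
  consider "\<xi> < xi_max R lb" | "\<xi> = xi_max R lb" | "\<xi> > xi_max R lb" by linarith
  then show ?thesis
  proof cases
    case 1
    define \<tau> where "\<tau> = tau R lb \<xi>"
    have \<tau>: "\<tau> > 0" unfolding \<tau>_def by (rule tau_pos[OF lb \<xi> 1])
    have "Pexp R lb \<xi> = ereal (h - \<xi> * ln \<tau> + log_gf R lb \<tau>)"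
      using 1 by (simp add: Pexp_def Let_def \<tau>_def h_def log_gf_def)
    then show ?thesis using Xle[OF \<tau>] by (simp only: q_def[symmetric] eexp ereal_less_eq)
  next
    case 2
    have "Pexp R lb \<xi> = ereal (h + lim)"
      using 2 by (simp add: Pexp_def Let_def h_def lim_def)
    moreover have "X \<le> exp (2 ^ T * (h + lim) + q)"
      by (rule tendsto_lowerbound[OF lim1]) (use Xu 2 in simp_all)
    ultimately show ?thesis by (simp only: q_def[symmetric] eexp ereal_less_eq)
  next
    case 3
    have "filterlim (\<lambda>\<tau>. - (2 ^ T * (\<xi> - xi_max R lb)) * ln \<tau>) at_bot at_top"
      using 3 by (intro filterlim_tendsto_neg_mult_at_bot[OF tendsto_const _ ln_at_top]) simp
    then have "((\<lambda>\<tau>. exp (- (2 ^ T * (\<xi> - xi_max R lb)) * ln \<tau>)) \<longlongrightarrow> 0) at_top"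
      by (rule filterlim_compose[OF exp_at_bot])
    from tendsto_mult[OF lim1 this] have "X \<le> exp (2 ^ T * (h + lim) + q) * 0"
      by (rule tendsto_lowerbound) (use Xu in simp_all)
    then have "X = 0" using X by simp
    moreover have "Pexp R lb \<xi> = - \<infinity>"
      using 3 by (simp add: Pexp_def Let_def)
    ultimately show ?thesis by (simp add: eexp_def)
  qed
qed

end

section \<open>Assignments and the ensemble\<close>

lemma ensemble_cong:
  assumes "H0 \<in> ensemble n L" "H \<in> carrier_mat n n"
    and "\<And>i. i < n \<Longrightarrow> row_sum H i = row_sum H0 i"
    and "\<And>j. j < n \<Longrightarrow> col_sum H j = col_sum H0 j"
  shows "H \<in> ensemble n L"
proof -
  have count: "{j. j < n \<and> col_sum H j = l} = {j. j < n \<and> col_sum H0 j = l}" for l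
    using assms(4) by auto
  have *: "\<And>i j. i \<le> j \<Longrightarrow> j < n \<Longrightarrow> row_sum H0 i \<le> row_sum H0 j"
    "\<And>i j. i \<le> j \<Longrightarrow> j < n \<Longrightarrow> col_sum H0 i \<le> col_sum H0 j"
    "\<And>l. real (card {j. j < n \<and> col_sum H0 j = l}) = coeff L l * real n"
    "\<And>i. i < n \<Longrightarrow> row_sum H0 i =
        (if real i < R1 (avg_deg L) * real n then r1 (avg_deg L) else r2 (avg_deg L))"
    using assms(1) unfolding ensemble_def by blast+
  show ?thesis
    unfolding ensemble_def mem_Collect_eq count
  proof (intro conjI allI impI)
    fix i j :: nat assume ij: "i \<le> j" "j < n"
    then have "i < n" by simp
    then show "row_sum H i \<le> row_sum H j" "col_sum H i \<le> col_sum H j"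
      unfolding assms(3)[OF ij(2)] assms(4)[OF ij(2)] assms(3)[OF \<open>i < n\<close>] assms(4)[OF \<open>i < n\<close>]
      using *(1,2)[OF ij] by -
  next
    fix i assume "i < n"
    then show "row_sum H i = (if real i < R1 (avg_deg L) * real n then r1 (avg_deg L) else r2 (avg_deg L))"
      by (simp only: assms(3) *(4))
  qed (rule assms(2) *(3))+
qed

lemma ensemble_carrier: "H \<in> ensemble n L \<Longrightarrow> H \<in> carrier_mat n n"
  unfolding ensemble_def by blast

lemmas ensemble_dims = carrier_matD[OF ensemble_carrier]

text \<open>The member \<open>H0\<close> witnesses that the ensemble is nonempty, and the size of
  its fibre serves as the common number of encodings of a matrix.\<close>

locale ensemble_sockets =
  fixes n :: nat and L :: "real poly" and H0 :: "bit mat"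
  assumes H0: "H0 \<in> ensemble n L"
begin

definition deg :: "nat \<Rightarrow> nat" where "deg = col_deg n L"
definition rdeg :: "nat \<Rightarrow> nat" where
  "rdeg i = (if real i < R1 (avg_deg L) * real n then r1 (avg_deg L) else r2 (avg_deg L))"
definition sockets :: "(nat \<times> nat) set" where "sockets = (SIGMA j:{..<n}. {..<deg j})"
definition asg :: "(nat \<times> nat \<Rightarrow> nat) set" where "asg = assignments sockets {..<n} rdeg"
definition mat_of :: "(nat \<times> nat \<Rightarrow> nat) \<Rightarrow> bit mat" where
  "mat_of f = mat n n (\<lambda>(r, j). if \<exists>t<deg j. f (j, t) = r then 1 else 0)"
definition ones :: "bit mat \<Rightarrow> nat \<Rightarrow> nat set" where "ones H j = {r. r < n \<and> H $$ (r, j) = 1}"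
text \<open>The repetition-free encodings of \<open>H\<close>. They differ only in the order of the
  sockets within each column, so a member of the ensemble has as many of them as the product of the
  factorials of its column sums.\<close>

definition fibre :: "bit mat \<Rightarrow> (nat \<times> nat \<Rightarrow> nat) set" where
  "fibre H = {f \<in> sockets \<rightarrow>\<^sub>E {..<n}. \<forall>j<n. bij_betw (\<lambda>t. f (j, t)) {..<deg j} (ones H j)}"

lemma finite_sockets: "finite sockets" by (simp add: sockets_def)

lemma card_ones: "H \<in> ensemble n L \<Longrightarrow> j < n \<Longrightarrow> card (ones H j) = deg j"
  using col_sum_ensemble[of H n L j]
  by (auto simp: ones_def deg_def col_sum_def ensemble_def)

lemma finite_ones: "finite (ones H j)" by (simp add: ones_def)

lemma row_sum_ensemble: "H \<in> ensemble n L \<Longrightarrow> i < n \<Longrightarrow> row_sum H i = rdeg i"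
  by (simp add: ensemble_def rdeg_def)

lemma column_sockets: "j < n \<Longrightarrow> {s\<in>sockets. fst s = j} = Pair j ` {..<deg j}"
  by (auto simp: sockets_def)

lemma simple_column:
  "j < n \<Longrightarrow> inj_on f {s\<in>sockets. fst s = j} \<longleftrightarrow> inj_on (\<lambda>t. f (j, t)) {..<deg j}"
  by (auto simp: column_sockets inj_on_def)

lemma fibre_row_count:
  assumes H: "H \<in> ensemble n L" and f: "f \<in> fibre H" and i: "i < n"
  shows "card {s\<in>sockets. f s = i} = rdeg i"
proof -
  have bij: "bij_betw (\<lambda>t. f (j, t)) {..<deg j} (ones H j)" if "j < n" for j
    using f that by (simp add: fibre_def)
  have "bij_betw fst {s\<in>sockets. f s = i} {j. j < n \<and> H $$ (i, j) = 1}"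
  proof (rule bij_betw_imageI)
    show "inj_on fst {s\<in>sockets. f s = i}"
    proof (rule inj_onI)
      fix s s' assume s: "s \<in> {s\<in>sockets. f s = i}" "s' \<in> {s\<in>sockets. f s = i}" "fst s = fst s'"
      then obtain j t t' where "s = (j, t)" "s' = (j, t')" "j < n" "t < deg j" "t' < deg j"
        by (auto simp: sockets_def)
      then show "s = s'" using s bij[of j] by (auto simp: bij_betw_def inj_on_def)
    qed
    show "fst ` {s\<in>sockets. f s = i} = {j. j < n \<and> H $$ (i, j) = 1}"
    proof (intro equalityI subsetI)
      fix j assume "j \<in> fst ` {s\<in>sockets. f s = i}"
      then obtain t where "j < n" "t < deg j" "f (j, t) = i" by (auto simp: sockets_def)
      then show "j \<in> {j. j < n \<and> H $$ (i, j) = 1}"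
        using bij[of j] by (auto simp: bij_betw_def ones_def)
    next
      fix j assume "j \<in> {j. j < n \<and> H $$ (i, j) = 1}"
      then have j: "j < n" "i \<in> ones H j" using i by (auto simp: ones_def)
      then have "i \<in> (\<lambda>t. f (j, t)) ` {..<deg j}" using bij[OF j(1)] by (simp add: bij_betw_def)
      then obtain t where "t < deg j" "f (j, t) = i" by auto
      then have "(j, t) \<in> {s\<in>sockets. f s = i}" using j by (simp add: sockets_def)
      then show "j \<in> fst ` {s\<in>sockets. f s = i}" by (rule rev_image_eqI) simp
    qed
  qed
  then have "card {s\<in>sockets. f s = i} = card {j. j < n \<and> H $$ (i, j) = 1}"
    by (rule bij_betw_same_card)
  also have "\<dots> = row_sum H i" using ensemble_dims[OF H] by (simp add: row_sum_def)
  finally show ?thesis using row_sum_ensemble[OF H i] by simp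
qed

lemma fibre_subset:
  assumes H: "H \<in> ensemble n L"
  shows "fibre H \<subseteq> {f \<in> asg. simple_on sockets fst {..<n} f}"
proof
  fix f assume f: "f \<in> fibre H"
  have "f \<in> asg"
    using f fibre_row_count[OF H f] by (simp add: asg_def assignments_def fibre_def)
  moreover have "simple_on sockets fst {..<n} f"
    using f by (auto simp: simple_on_def simple_column fibre_def bij_betw_def)
  ultimately show "f \<in> {f \<in> asg. simple_on sockets fst {..<n} f}" by simp
qed

lemma mat_of_fibre:
  assumes H: "H \<in> ensemble n L" and f: "f \<in> fibre H"
  shows "mat_of f = H"
proof (rule eq_matI)
  fix r j assume "r < dim_row H" "j < dim_col H"
  then have rj: "r < n" "j < n" using H by (auto simp: ensemble_def)
  have "(\<lambda>t. f (j, t)) ` {..<deg j} = ones H j" using f rj by (simp add: fibre_def bij_betw_def)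
  moreover have "(\<exists>t<deg j. f (j, t) = r) \<longleftrightarrow> r \<in> (\<lambda>t. f (j, t)) ` {..<deg j}" by auto
  ultimately have "(\<exists>t<deg j. f (j, t) = r) \<longleftrightarrow> H $$ (r, j) = 1"
    using rj by (simp add: ones_def)
  then show "mat_of f $$ (r, j) = H $$ (r, j)"
    using rj by (cases "H $$ (r, j)") (auto simp: mat_of_def)
qed (use H in \<open>auto simp: mat_of_def ensemble_def\<close>)

lemma simple_assignment_in_fibre:
  assumes f: "f \<in> asg" "simple_on sockets fst {..<n} f"
  shows "mat_of f \<in> ensemble n L" and "f \<in> fibre (mat_of f)"
proof -
  have fI: "f \<in> sockets \<rightarrow>\<^sub>E {..<n}" using f by (simp add: asg_def assignments_def)
  have inj: "inj_on (\<lambda>t. f (j, t)) {..<deg j}" if "j < n" for j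
    using f(2) that by (simp add: simple_on_def simple_column)
  have ones: "ones (mat_of f) j = (\<lambda>t. f (j, t)) ` {..<deg j}" if j: "j < n" for j
  proof -
    have "f (j, t) < n" if "t < deg j" for t
      using fI that j by (auto simp: sockets_def PiE_def Pi_def)
    then show ?thesis using j by (auto simp: ones_def mat_of_def split: if_splits)
  qed
  show fib: "f \<in> fibre (mat_of f)"
    using fI inj ones by (simp add: fibre_def bij_betw_def)
  have "col_sum (mat_of f) j = col_sum H0 j" if j: "j < n" for j
  proof -
    have "col_sum (mat_of f) j = card (ones (mat_of f) j)" by (simp add: col_sum_def ones_def mat_of_def)
    also have "\<dots> = deg j" using inj[OF j] by (simp add: ones[OF j] card_image)
    also have "\<dots> = col_sum H0 j" using col_sum_ensemble[OF H0 j] by (simp add: deg_def)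
    finally show ?thesis .
  qed
  moreover have "row_sum (mat_of f) i = row_sum H0 i" if i: "i < n" for i
  proof -
    have "row_sum (mat_of f) i = card {j. j < n \<and> (\<exists>t<deg j. f (j, t) = i)}"
      using i by (auto simp: row_sum_def mat_of_def intro!: arg_cong[where f = card] split: if_splits)
    also have "{j. j < n \<and> (\<exists>t<deg j. f (j, t) = i)} = fst ` {s\<in>sockets. f s = i}"
      by (force simp: sockets_def)
    also have "card \<dots> = card {s\<in>sockets. f s = i}"
    proof (rule card_image, rule inj_onI)
      fix s s' assume s: "s \<in> {s\<in>sockets. f s = i}" "s' \<in> {s\<in>sockets. f s = i}" "fst s = fst s'"
      then obtain j t t' where "s = (j, t)" "s' = (j, t')" "j < n" "t < deg j" "t' < deg j"
        by (auto simp: sockets_def)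
      then show "s = s'" using s inj[of j] by (auto simp: inj_on_def)
    qed
    also have "\<dots> = rdeg i" using f(1) i by (simp add: asg_def assignments_def)
    finally show ?thesis using row_sum_ensemble[OF H0 i] by simp
  qed
  moreover have "mat_of f \<in> carrier_mat n n" by (simp add: mat_of_def)
  ultimately show "mat_of f \<in> ensemble n L" by (intro ensemble_cong[OF H0])
qed

lemma finite_fibre: "finite (fibre H)"
  by (rule finite_subset[of _ "sockets \<rightarrow>\<^sub>E {..<n}"])
    (auto simp: fibre_def finite_sockets intro: finite_PiE)

text \<open>Bijections between the sets of ones in corresponding columns carry encodings of
  \<open>H\<close> to encodings of \<open>H'\<close>. The two matrices may be interchanged, so
  equality follows.\<close>

lemma card_fibre_le:
  assumes H: "H \<in> ensemble n L" "H' \<in> ensemble n L"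
  shows "card (fibre H) \<le> card (fibre H')"
proof -
  have "\<exists>\<phi>. bij_betw \<phi> (ones H j) (ones H' j)" if "j < n" for j
    using finite_same_card_bij[OF finite_ones finite_ones] card_ones[OF H(1) that] card_ones[OF H(2) that] by simp
  then obtain \<phi> where \<phi>: "\<And>j. j < n \<Longrightarrow> bij_betw (\<phi> j) (ones H j) (ones H' j)" by metis
  define h where "h f = (\<lambda>s\<in>sockets. \<phi> (fst s) (f s))" for f :: "nat \<times> nat \<Rightarrow> nat"
  have hj: "h f (j, t) = \<phi> j (f (j, t))" if "j < n" "t < deg j" for f j t
    using that by (simp add: h_def sockets_def)
  have val: "f (j, t) \<in> ones H j" if "f \<in> fibre H" "j < n" "t < deg j" for f j t
    using that by (auto simp: fibre_def bij_betw_def)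
  show ?thesis
  proof (rule card_inj_on_le[of h])
    show "inj_on h (fibre H)"
    proof (rule inj_onI)
      fix f f' assume f: "f \<in> fibre H" "f' \<in> fibre H" and eq: "h f = h f'"
      have "f s = f' s" if sS: "s \<in> sockets" for s
      proof -
        obtain j t where s: "s = (j, t)" "j < n" "t < deg j" using sS by (auto simp: sockets_def)
        have "\<phi> j (f (j, t)) = \<phi> j (f' (j, t))" using fun_cong[OF eq, of "(j, t)"] s by (simp add: hj)
        then show ?thesis
          using \<phi>[OF s(2)] val[OF f(1) s(2,3)] val[OF f(2) s(2,3)] s(1)
          by (auto simp: bij_betw_def inj_on_def)
      qed
      then show "f = f'" using f
        by (intro PiE_ext[of f sockets "\<lambda>_. {..<n}" f']) (auto simp: fibre_def)
    qed
    show "h ` fibre H \<subseteq> fibre H'"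
    proof (rule image_subsetI)
      fix f assume f: "f \<in> fibre H"
      have "bij_betw (\<lambda>t. h f (j, t)) {..<deg j} (ones H' j)" if j: "j < n" for j
      proof -
        have "bij_betw (\<lambda>t. f (j, t)) {..<deg j} (ones H j)" using f j by (simp add: fibre_def)
        then have "bij_betw (\<phi> j \<circ> (\<lambda>t. f (j, t))) {..<deg j} (ones H' j)"
          using \<phi>[OF j] by (rule bij_betw_trans)
        then show ?thesis by (rule bij_betw_cong[THEN iffD1, rotated]) (simp add: hj j)
      qed
      moreover have "h f \<in> sockets \<rightarrow>\<^sub>E {..<n}"
      proof (rule PiE_I)
        fix s assume "s \<in> sockets"
        then obtain j t where s: "s = (j, t)" "j < n" "t < deg j" by (auto simp: sockets_def)
        then have "h f s \<in> ones H' j" using val[OF f s(2,3)] \<phi>[OF s(2)] by (auto simp: hj bij_betw_def)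
        then show "h f s \<in> {..<n}" by (simp add: ones_def)
      qed (simp add: h_def)
      ultimately show "h f \<in> fibre H'" by (simp add: fibre_def)
    qed
  qed (rule finite_fibre)
qed

lemma fibre_nonempty:
  assumes H: "H \<in> ensemble n L"
  shows "fibre H \<noteq> {}"
proof -
  have "\<exists>\<phi>. bij_betw \<phi> {..<deg j} (ones H j)" if "j < n" for j
    using finite_same_card_bij[of "{..<deg j}" "ones H j"] finite_ones card_ones[OF H that] by simp
  then obtain \<phi> where \<phi>: "\<And>j. j < n \<Longrightarrow> bij_betw (\<phi> j) {..<deg j} (ones H j)" by metis
  define f where "f = (\<lambda>s\<in>sockets. \<phi> (fst s) (snd s))"
  have fj: "f (j, t) = \<phi> j t" if "j < n" "t < deg j" for j t
    using that by (simp add: f_def sockets_def)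
  have "bij_betw (\<lambda>t. f (j, t)) {..<deg j} (ones H j)" if j: "j < n" for j
    using \<phi>[OF j] by (rule bij_betw_cong[THEN iffD1, rotated]) (simp add: fj j)
  moreover have "f \<in> sockets \<rightarrow>\<^sub>E {..<n}"
  proof (rule PiE_I)
    fix s assume "s \<in> sockets"
    then obtain j t where s: "s = (j, t)" "j < n" "t < deg j" by (auto simp: sockets_def)
    then have "f s \<in> ones H j" using \<phi>[OF s(2)] by (auto simp: fj bij_betw_def)
    then show "f s \<in> {..<n}" by (simp add: ones_def)
  qed (simp add: f_def)
  ultimately show ?thesis by (auto simp: fibre_def)
qed

lemma card_fibre_eq: "H \<in> ensemble n L \<Longrightarrow> card (fibre H) = card (fibre H0)"
  using card_fibre_le H0 by (meson le_antisym)

lemma finite_asg: "finite asg"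
  unfolding asg_def by (rule finite_assignments[OF finite_sockets finite_lessThan])

lemma finite_ensemble: "finite (ensemble n L)"
proof -
  have "ensemble n L \<subseteq> mat_of ` asg"
  proof
    fix H assume H: "H \<in> ensemble n L"
    then obtain f where "f \<in> fibre H" using fibre_nonempty by blast
    then show "H \<in> mat_of ` asg" using fibre_subset[OF H] mat_of_fibre[OF H] by blast
  qed
  then show ?thesis by (rule finite_subset) (simp add: finite_asg)
qed

lemma card_simple_le:
  "card {f \<in> asg. simple_on sockets fst {..<n} f} \<le> card (ensemble n L) * card (fibre H0)"
proof -
  have "{f \<in> asg. simple_on sockets fst {..<n} f} \<subseteq> (\<Union>H\<in>ensemble n L. fibre H)"
    using simple_assignment_in_fibre by blast
  then have "card {f \<in> asg. simple_on sockets fst {..<n} f} \<le> card (\<Union>H\<in>ensemble n L. fibre H)"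
    by (intro card_mono) (auto simp: finite_ensemble finite_fibre)
  also have "\<dots> \<le> (\<Sum>H\<in>ensemble n L. card (fibre H))" by (rule card_UN_le[OF finite_ensemble])
  finally show ?thesis by (simp add: card_fibre_eq)
qed

text \<open>Fibres of different matrices are disjoint because \<open>mat_of\<close> recovers the
  matrix. Together with \<open>card_simple_le\<close> this turns proportions of matrices into
  proportions of assignments.\<close>

lemma card_subensemble_le:
  assumes X: "X \<subseteq> ensemble n L" and Y: "finite Y" and sub: "\<And>H. H \<in> X \<Longrightarrow> fibre H \<subseteq> Y"
  shows "card X * card (fibre H0) \<le> card Y"
proof -
  have "finite X" using X finite_ensemble by (rule finite_subset)
  moreover have "fibre H \<inter> fibre H' = {}" if "H \<in> X" "H' \<in> X" "H \<noteq> H'" for H H'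
    using that X mat_of_fibre by blast
  ultimately have "card (\<Union>H\<in>X. fibre H) = (\<Sum>H\<in>X. card (fibre H))"
    by (intro card_UN_disjoint) (auto simp: finite_fibre)
  also have "\<dots> = (\<Sum>H\<in>X. card (fibre H0))"
    using X by (intro sum.cong refl card_fibre_eq) auto
  finally have "card X * card (fibre H0) = card (\<Union>H\<in>X. fibre H)" by simp
  also have "\<dots> \<le> card Y" using sub by (intro card_mono Y) blast
  finally show ?thesis .
qed

text \<open>An entry of the accumulated matrix is the parity of the number of ones of its column
  inside the block. Summing over the support therefore gives, over the two-element field, the number
  of support sockets assigned to the block.\<close>

lemma kernel_parity:
  assumes n: "n = 2 ^ T" and i: "1 \<le> i" "i \<le> 2 ^ T" and H: "H \<in> ensemble n L"
    and x: "x \<in> carrier_vec n" and ker: "acc_mat T i H *\<^sub>v x = 0\<^sub>v i"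
    and f: "f \<in> fibre H" and k: "k < i"
  shows "even (card {s \<in> {s\<in>sockets. fst s \<in> supp x}. block_of T i (f s) = k})"
proof -
  define B where "B = {r. r < 2 ^ T \<and> block_of T i r = k}"
  have finB: "finite B" by (simp add: B_def)
  have entry: "acc_mat T i H $$ (k, j) = of_nat (card {r\<in>B. H $$ (r, j) = 1})" if "j < n" for j
  proof -
    have "acc_mat T i H $$ (k, j) = (\<Sum>r\<in>acc_block T i (k + 1). H $$ (r - 1, j))"
      using k that n by (simp add: acc_mat_def)
    also have "\<dots> = (\<Sum>r\<in>B. H $$ (r, j))"
      unfolding acc_block_eq[OF i k] B_def by (subst sum.reindex) auto
    also have "\<dots> = (\<Sum>r\<in>B. if H $$ (r, j) = 1 then 1 else 0)"
      by (intro sum.cong refl) (metis bit_not_one_iff)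
    also have "\<dots> = of_nat (card {r\<in>B. H $$ (r, j) = 1})"
      using finB by (simp add: sum.If_cases Int_def)
    finally show ?thesis .
  qed
  have supp: "supp x \<subseteq> {..<n}" using x by (auto simp: supp_def)
  have cardj: "card {r\<in>B. H $$ (r, j) = 1} = card {t. t < deg j \<and> f (j, t) \<in> B}" if j: "j < n" for j
  proof -
    have bij: "bij_betw (\<lambda>t. f (j, t)) {..<deg j} (ones H j)" using f j by (simp add: fibre_def)
    have "card {t\<in>{..<deg j}. f (j, t) \<in> B} = card {r\<in>ones H j. r \<in> B}"
      using card_filter_bij[OF bij, of "\<lambda>r. r \<in> B"] .
    moreover have "{r\<in>ones H j. r \<in> B} = {r\<in>B. H $$ (r, j) = 1}"
      by (auto simp: ones_def B_def n[symmetric])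
    ultimately show ?thesis by simp
  qed
  have "0 = vec_index (acc_mat T i H *\<^sub>v x) k" using ker k by simp
  also have "\<dots> = (\<Sum>j<n. acc_mat T i H $$ (k, j) * vec_index x j)"
    using k x n by (simp add: acc_mat_def scalar_prod_def lessThan_atLeast0)
  also have "\<dots> = (\<Sum>j\<in>supp x. acc_mat T i H $$ (k, j) * vec_index x j)"
    using supp x by (intro sum.mono_neutral_right) (auto simp: supp_def)
  also have "\<dots> = (\<Sum>j\<in>supp x. of_nat (card {t. t < deg j \<and> f (j, t) \<in> B}))"
  proof (rule sum.cong[OF refl])
    fix j assume j: "j \<in> supp x"
    then have "vec_index x j = 1" by (simp add: supp_def)
    then show "acc_mat T i H $$ (k, j) * vec_index x j = of_nat (card {t. t < deg j \<and> f (j, t) \<in> B})"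
      using j supp entry[of j] cardj[of j] by auto
  qed
  also have "\<dots> = of_nat (\<Sum>j\<in>supp x. card {t. t < deg j \<and> f (j, t) \<in> B})" by simp
  also have "(\<Sum>j\<in>supp x. card {t. t < deg j \<and> f (j, t) \<in> B})
      = card (SIGMA j:supp x. {t. t < deg j \<and> f (j, t) \<in> B})"
    using supp by (subst card_SigmaI) (auto intro: finite_subset)
  also have "(SIGMA j:supp x. {t. t < deg j \<and> f (j, t) \<in> B})
      = {s \<in> {s\<in>sockets. fst s \<in> supp x}. block_of T i (f s) = k}"
    using supp f by (auto simp: sockets_def B_def fibre_def PiE_def Pi_def n[symmetric])
  finally have zero: "(0 :: bit) = of_nat (card {s \<in> {s\<in>sockets. fst s \<in> supp x}. block_of T i (f s) = k})" .
  \<comment> \<open>The element 0 of \<open>bit\<close> is even, and \<open>even_of_nat_iff\<close>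
    carries this parity back to the natural numbers.\<close>
  have "even (of_nat (card {s \<in> {s\<in>sockets. fst s \<in> supp x}. block_of T i (f s) = k}) :: bit)"
    unfolding zero[symmetric] by simp
  then show ?thesis by (simp only: even_of_nat_iff)
qed

end

section \<open>Degree counts and the bound for the fraction of matrices\<close>

lemma avg_deg_altdef: "avg_deg L = (\<Sum>l\<le>degree L. coeff L l * real l)"
proof (cases "degree L")
  case 0
  then have "pderiv L = 0" by (simp add: pderiv_eq_0_iff)
  then show ?thesis using 0 by (simp add: avg_deg_def)
next
  case (Suc m)
  have "avg_deg L = (\<Sum>i\<le>m. coeff (pderiv L) i)"
    by (simp add: avg_deg_def poly_altdef degree_pderiv Suc)
  also have "\<dots> = (\<Sum>i\<le>m. coeff L (Suc i) * real (Suc i))"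
    by (simp add: coeff_pderiv mult.commute)
  also have "\<dots> = (\<Sum>l\<le>degree L. coeff L l * real l)"
    unfolding Suc sum.atMost_Suc_shift by simp
  finally show ?thesis .
qed

lemma min_deg_le: "coeff L l \<noteq> 0 \<Longrightarrow> min_deg L \<le> l"
proof -
  assume l: "coeff L l \<noteq> 0"
  have "{l. coeff L l \<noteq> 0} \<subseteq> {..degree L}" using le_degree by auto
  then have "finite {l. coeff L l \<noteq> 0}" by (rule finite_subset) simp
  then show ?thesis using l by (simp add: min_deg_def)
qed

lemma avg_deg_ge:
  assumes "degree_distribution L" "min_deg L \<ge> d"
  shows "avg_deg L \<ge> real d"
proof -
  have "real d = (\<Sum>l\<le>degree L. coeff L l * real d)"
    using assms(1) by (simp add: degree_distribution_def sum_distrib_right[symmetric])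
  also have "\<dots> \<le> (\<Sum>l\<le>degree L. coeff L l * real l)"
  proof (rule sum_mono)
    fix l
    show "coeff L l * real d \<le> coeff L l * real l"
      using assms min_deg_le[of L l] by (cases "coeff L l = 0") (auto simp: degree_distribution_def intro!: mult_left_mono)
  qed
  finally show ?thesis by (simp add: avg_deg_altdef)
qed

context ensemble_sockets
begin

lemma coeff_deg: "j < n \<Longrightarrow> coeff L (deg j) \<noteq> 0"
proof
  assume j: "j < n" and 0: "coeff L (deg j) = 0"
  have "real (card {j'. j' < n \<and> col_sum H0 j' = deg j}) = coeff L (deg j) * real n"
    using H0 unfolding ensemble_def by blast
  then have "{j'. j' < n \<and> col_sum H0 j' = deg j} = {}" using 0 by simp
  moreover have "col_sum H0 j = deg j" using col_sum_ensemble[OF H0 j] by (simp add: deg_def)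
  ultimately show False using j by blast
qed

lemma deg_le: "j < n \<Longrightarrow> deg j \<le> degree L"
  using coeff_deg by (rule le_degree)

lemma deg_ge: "j < n \<Longrightarrow> min_deg L \<le> deg j"
  using coeff_deg by (rule min_deg_le)

lemma sum_deg:
  assumes "\<kappa> \<subseteq> {..<n}"
  shows "real (\<Sum>j\<in>\<kappa>. deg j) = (\<Sum>l\<le>degree L. real (card {j\<in>\<kappa>. deg j = l}) * real l)"
proof -
  have "(\<Sum>j\<in>\<kappa>. deg j) = (\<Sum>l\<le>degree L. \<Sum>j\<in>{j\<in>\<kappa>. deg j = l}. deg j)"
    using assms deg_le by (intro sum.group[symmetric]) (auto intro: finite_subset)
  also have "\<dots> = (\<Sum>l\<le>degree L. card {j\<in>\<kappa>. deg j = l} * l)" by (intro sum.cong) auto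
  finally show ?thesis by simp
qed

text \<open>With \<open>card_sockets\<close> this makes the proportion of sockets in the support
  equal to \<open>avg_deg_supp n L \<kappa> / avg_deg L\<close>, the argument of the
  entropy.\<close>

lemma sum_deg_supp:
  assumes "\<kappa> \<subseteq> {..<n}"
  shows "real (\<Sum>j\<in>\<kappa>. deg j) = avg_deg_supp n L \<kappa> * real n"
proof (cases "n = 0")
  case False
  then show ?thesis
    unfolding sum_deg[OF assms] avg_deg_supp_def Lsup_def deg_def[symmetric] by (simp add: sum_distrib_right)
qed (use assms in simp)

lemma card_sockets: "real (card sockets) = avg_deg L * real n"
proof -
  have "card sockets = (\<Sum>j<n. deg j)" by (simp add: sockets_def card_SigmaI)
  moreover have "real (card {j\<in>{..<n}. deg j = l}) = coeff L l * real n" for l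
  proof -
    have "{j\<in>{..<n}. deg j = l} = {j. j < n \<and> col_sum H0 j = l}"
      using col_sum_ensemble[OF H0] by (auto simp: deg_def)
    moreover have "real (card {j. j < n \<and> col_sum H0 j = l}) = coeff L l * real n"
      using H0 unfolding ensemble_def by blast
    ultimately show ?thesis by simp
  qed
  ultimately show ?thesis
    using sum_deg[of "{..<n}"] by (simp add: avg_deg_altdef sum_distrib_left mult_ac)
qed

lemma card_support_sockets:
  assumes "\<kappa> \<subseteq> {..<n}"
  shows "card {s\<in>sockets. fst s \<in> \<kappa>} = (\<Sum>j\<in>\<kappa>. deg j)"
proof -
  have "{s\<in>sockets. fst s \<in> \<kappa>} = (SIGMA j:\<kappa>. {..<deg j})" using assms by (auto simp: sockets_def)
  then show ?thesis using assms by (simp add: card_SigmaI finite_subset)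
qed

text \<open>The first summand is the switching constant, valid for \<open>n \<ge> 4 * k\<close>. For
  smaller \<open>n\<close> the second one bounds the number of all maps from sockets to rows, which
  suffices because some repetition-free assignment exists. Both depend on \<open>L\<close>
  only.\<close>

definition simple_const :: real where
  "simple_const = (let k = degree L * degree L * r2 (avg_deg L) in
     exp (4 * real k) + real ((4 * k) ^ (4 * k * degree L)))"

lemma card_asg_le:
  assumes n: "n > 0" and dd: "degree_distribution L" "min_deg L \<ge> 2"
  shows "real (card asg) \<le> simple_const * real (card {f \<in> asg. simple_on sockets fst {..<n} f})"
proof -
  define k where "k = degree L * degree L * r2 (avg_deg L)"
  let ?F = "{f \<in> asg. simple_on sockets fst {..<n} f}"
  have D: "simple_const = exp (4 * real k) + real ((4 * k) ^ (4 * k * degree L))"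
    by (simp add: simple_const_def k_def Let_def)
  have lb: "avg_deg L \<ge> 2" using avg_deg_ge[OF dd] by simp
  have col: "card {s\<in>sockets. fst s = c} \<le> degree L" for c
  proof (cases "c < n")
    case True
    then show ?thesis using deg_le[OF True] by (simp add: column_sockets card_image inj_on_def)
  next
    case False
    then have "{s\<in>sockets. fst s = c} = {}" by (auto simp: sockets_def)
    then show ?thesis by (simp only: card.empty le0)
  qed
  have r12: "r1 (avg_deg L) \<le> r2 (avg_deg L)"
    unfolding r1_def r2_def by (intro nat_mono) linarith
  then have row: "rdeg i \<le> r2 (avg_deg L)" for i by (simp add: rdeg_def)
  have "1 * real n \<le> avg_deg L * real n" using lb by (intro mult_right_mono) auto
  then have nS: "n \<le> card sockets" unfolding card_sockets[symmetric] by simp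
  have l2: "degree L \<ge> 2" using deg_le[OF n] deg_ge[OF n] dd(2) by linarith
  have F1: "real (card ?F) \<ge> 1"
  proof -
    have "?F \<noteq> {}" using fibre_nonempty[OF H0] fibre_subset[OF H0] by blast
    then have "card ?F > 0" using finite_asg by (simp add: card_gt_0_iff)
    then show ?thesis by simp
  qed
  show ?thesis
  proof (cases "n \<ge> 4 * k")
    case True
    have "2 * r2 (avg_deg L) * degree L \<le> 4 * k"
      using l2 mult_le_mono1[of 1 "degree L" "degree L * r2 (avg_deg L)"] by (simp add: k_def mult_ac)
    then have "card sockets \<ge> 2 * r2 (avg_deg L) * degree L" using True nS by linarith
    moreover have "card sockets \<ge> 4 * degree L * degree L * r2 (avg_deg L)"
      using True nS by (simp add: k_def mult.assoc)
    moreover have "card sockets > 0" using nS n by linarith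
    ultimately have big: "card sockets \<ge> 2 * r2 (avg_deg L) * degree L"
      "card sockets \<ge> 4 * degree L * degree L * r2 (avg_deg L)" "card sockets > 0" by blast+
    have "real (card asg) \<le> exp (4 * real k) * real (card ?F)"
      unfolding asg_def k_def
      by (rule simple_assignments_bound[OF finite_sockets finite_lessThan finite_lessThan col row big])
        (use nS in simp)
    also have "\<dots> \<le> simple_const * real (card ?F)"
      unfolding D by (intro mult_right_mono) simp_all
    finally show ?thesis .
  next
    case False
    have "real (card sockets) \<le> real (n * degree L)"
    proof -
      have "card sockets = (\<Sum>j<n. deg j)" by (simp add: sockets_def card_SigmaI)
      also have "\<dots> \<le> (\<Sum>j<n. degree L)" using deg_le by (intro sum_mono) auto
      finally show ?thesis by (simp only: of_nat_le_iff) simp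
    qed
    then have "card sockets \<le> n * degree L" by (simp only: of_nat_le_iff)
    then have cS: "card sockets \<le> 4 * k * degree L" using False by (meson le_trans mult_le_mono1 nat_le_linear)
    have "card asg \<le> card (sockets \<rightarrow>\<^sub>E {..<n})"
      unfolding asg_def assignments_def by (intro card_mono finite_PiE finite_sockets) auto
    also have "\<dots> = n ^ card sockets" by (simp add: card_PiE finite_sockets)
    also have "\<dots> \<le> (4 * k) ^ card sockets" using False by (intro power_mono) auto
    also have "\<dots> \<le> (4 * k) ^ (4 * k * degree L)" using cS False n by (intro power_increasing) auto
    finally have "real (card asg) \<le> real ((4 * k) ^ (4 * k * degree L))" by (rule of_nat_mono)
    also have "\<dots> \<le> simple_const" by (simp add: D)
    also have "\<dots> \<le> simple_const * real (card ?F)"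
      using mult_left_mono[OF F1, of simple_const] by (simp add: D)
    finally show ?thesis .
  qed
qed

lemma simple_const_ge_1: "simple_const \<ge> 1"
proof -
  have "1 \<le> exp (4 * real (degree L * degree L * r2 (avg_deg L)))" by simp
  moreover have "0 \<le> real ((4 * (degree L * degree L * r2 (avg_deg L))) ^ (4 * (degree L * degree L * r2 (avg_deg L)) * degree L))"
    by (rule of_nat_0_le_iff)
  ultimately show ?thesis unfolding simple_const_def Let_def by linarith
qed

text \<open>The numerator is passed to assignments by \<open>card_subensemble_le\<close>, the
  denominator by \<open>card_simple_le\<close> and \<open>card_asg_le\<close>; the common fibre size
  \<open>W\<close> cancels.\<close>

lemma kernel_fraction_bound:
  fixes x :: "bit Matrix.vec" and a :: nat
  assumes dd: "degree_distribution L" "min_deg L \<ge> 2"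
    and n: "n = 2 ^ T" and i: "1 \<le> i" "i \<le> 2 ^ T" and x: "x \<in> carrier_vec n"
    and a: "real a = R1 (avg_deg L) * 2 ^ T" and \<tau>: "\<tau> > 0"
  defines "Z \<equiv> {H \<in> ensemble n L. acc_mat T i H *\<^sub>v x = 0\<^sub>v i}"
    and "w \<equiv> card {s\<in>sockets. fst s \<in> supp x}"
  shows "real (card Z) / real (card (ensemble n L)) * real (card sockets choose w) * \<tau> ^ w
     \<le> simple_const * exp (2 ^ T * log_gf (real i / 2 ^ T) (avg_deg L) \<tau>)"
proof -
  define K where "K = {s\<in>sockets. fst s \<in> supp x}"
  define Y where "Y = parity_assignments sockets {..<n} rdeg {..<i} (block_of T i) K"
  define W where "W = real (card (fibre H0))"
  define e where "e = exp (2 ^ T * log_gf (real i / 2 ^ T) (avg_deg L) \<tau>)"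
  define V where "V = real (card sockets choose w) * \<tau> ^ w"
  let ?E = "real (card (ensemble n L))"
  have n0: "n > 0" by (simp add: n)
  have V: "V \<ge> 0" using \<tau> by (simp add: V_def)
  have "card (fibre H0) > 0" using fibre_nonempty[OF H0] finite_fibre by (simp add: card_gt_0_iff)
  then have W: "W > 0" by (simp add: W_def)
  have "card (ensemble n L) > 0" using H0 finite_ensemble by (auto simp: card_gt_0_iff)
  then have E: "?E > 0" by simp
  have "card Z * card (fibre H0) \<le> card Y"
  proof (rule card_subensemble_le)
    show "Z \<subseteq> ensemble n L" by (auto simp: Z_def)
    show "finite Y" unfolding Y_def parity_assignments_def
      using finite_asg by (simp add: asg_def)
    fix H assume "H \<in> Z"
    then have H: "H \<in> ensemble n L" "acc_mat T i H *\<^sub>v x = 0\<^sub>v i" by (auto simp: Z_def)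
    show "fibre H \<subseteq> Y"
    proof
      fix f assume f: "f \<in> fibre H"
      then have "f \<in> asg" using fibre_subset[OF H(1)] by blast
      then show "f \<in> Y" using kernel_parity[OF n i H(1) x H(2) f]
        by (simp add: Y_def parity_assignments_def K_def asg_def)
    qed
  qed
  then have "real (card Z * card (fibre H0)) \<le> real (card Y)" by (rule of_nat_mono)
  then have 1: "real (card Z) * W \<le> real (card Y)" by (simp add: W_def)
  have "real (card Y) * V \<le> real (card asg) * (\<Prod>k<i. g \<tau> (\<Sum>r | r \<in> {..<n} \<and> block_of T i r = k. rdeg r) / 2)"
  proof -
    have blk: "block_of T i ` {..<n} \<subseteq> {..<i}" using block_of_less[OF i] by (auto simp: n)
    have K: "K \<subseteq> sockets" by (auto simp: K_def)
    show ?thesis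
      unfolding Y_def asg_def V_def w_def K_def[symmetric] mult.assoc[symmetric]
      by (rule parity_assignments_bound[OF finite_sockets finite_lessThan finite_lessThan blk K \<tau>])
  qed
  also have "(\<Prod>k<i. g \<tau> (\<Sum>r | r \<in> {..<n} \<and> block_of T i r = k. rdeg r) / 2) \<le> e"
  proof -
    have rn: "real n = 2 ^ T" by (simp add: n)
    have rd: "rdeg = (\<lambda>r. if real r < R1 (avg_deg L) * 2 ^ T then r1 (avg_deg L) else r2 (avg_deg L))"
      by (simp add: rdeg_def rn fun_eq_iff)
    have rows: "{..<n} = {..<2 ^ T}" by (simp add: n)
    show ?thesis
      unfolding rows rd e_def prod_rows_eq[OF i a refl \<tau>, symmetric] by (rule prod_blocks_le[OF i \<tau>])
  qed
  finally have 2: "real (card Y) * V \<le> real (card asg) * e" by (simp add: mult_left_mono)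
  have "real (card {f \<in> asg. simple_on sockets fst {..<n} f}) \<le> ?E * W"
    using of_nat_mono[OF card_simple_le, where 'a = real] by (simp add: W_def)
  then have "simple_const * real (card {f \<in> asg. simple_on sockets fst {..<n} f}) \<le> simple_const * (?E * W)"
    using simple_const_ge_1 by (intro mult_left_mono) auto
  then have 3: "real (card asg) \<le> simple_const * (?E * W)" using card_asg_le[OF n0 dd] by linarith
  have "real (card Z) * W * V \<le> real (card Y) * V" by (rule mult_right_mono[OF 1 V])
  also note 2
  also have "real (card asg) * e \<le> simple_const * (?E * W) * e"
    using 3 by (rule mult_right_mono) (simp add: e_def)
  finally have "real (card Z) * V * W \<le> simple_const * e * ?E * W" by (simp add: mult_ac)
  then have "real (card Z) * V \<le> simple_const * e * ?E" using W by (rule mult_right_le_imp_le)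
  then have "real (card Z) * V / ?E \<le> simple_const * e" using E by (simp add: pos_divide_le_eq)
  then show ?thesis by (simp add: V_def e_def mult_ac)
qed

end

text \<open>The maximum with \<open>1 / real n\<close> in \<open>hat_deg_supp\<close> makes the
  first logarithm in \<open>corr\<close> nonnegative, so \<open>corr\<close> dominates the term
  produced by Stirling's formula.\<close>

lemma corr_ge:
  assumes "n > 0" "avg_deg L \<ge> 0"
  shows "1 / 2 * ln (real n * avg_deg_supp n L \<kappa> * (1 - avg_deg_supp n L \<kappa> / avg_deg L)) \<le> corr n i L \<kappa>"
proof -
  have "1 / real n \<le> hat_deg_supp n L \<kappa>" by (simp add: hat_deg_supp_def)
  then have "1 \<le> real n * hat_deg_supp n L \<kappa>" using assms by (simp add: field_simps)
  then have "0 \<le> 3 * real n * of_int \<lceil>avg_deg L\<rceil> / real i * ln (real n * hat_deg_supp n L \<kappa>)"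
    using assms(2) by (intro mult_nonneg_nonneg divide_nonneg_nonneg) auto
  then show ?thesis by (simp add: corr_def)
qed

theorem lemma1:
  fixes L :: "real poly" and N :: "nat set" and \<Delta> :: "nat \<Rightarrow> nat"
  assumes "degree_distribution L"
    and "min_deg L \<ge> 2"
    and "\<And>n. n \<in> N \<Longrightarrow> admissible L (\<Delta> n) n"
    and "((\<lambda>n. real (\<Delta> n) / sqrt (real n)) \<longlongrightarrow> 1) (inf sequentially (principal N))"
  shows "\<exists>E :: nat \<Rightarrow> real. E \<in> O(\<lambda>_. 1) \<and>
    (\<forall>n T b. \<forall>x \<in> carrier_vec n.
       n \<in> N \<longrightarrow> n = 2 ^ T \<longrightarrow> 1 \<le> b \<longrightarrow> b \<le> n div \<Delta> n \<longrightarrow> x \<noteq> 0\<^sub>v n \<longrightarrow>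
       ereal (measure (uniform_count_measure (ensemble n L))
                {H \<in> ensemble n L. acc_mat T (b * \<Delta> n) H *\<^sub>v x = 0\<^sub>v (b * \<Delta> n)})
       \<le> eexp (ereal (real n) *
                 Pexp (real (b * \<Delta> n) / real n) (avg_deg L) (avg_deg_supp n L (supp x)) +
               ereal (corr n (b * \<Delta> n) L (supp x) + E n)))"
proof -
  define k where "k = degree L * degree L * r2 (avg_deg L)"
  define D where "D = exp (4 * real k) + real ((4 * k) ^ (4 * k * degree L))"
  have lb: "avg_deg L \<ge> 2" using avg_deg_ge[OF assms(1,2)] by simp
  show ?thesis
  \<comment> \<open>The error can be a constant sequence: \<open>D\<close> is the cost of replacing
    matrices by assignments and 5/4 the error in the binomial coefficient.\<close>
  proof (intro exI[of _ "\<lambda>_. ln D + 5/4"] conjI allI ballI impI)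
    fix n T b :: nat and x :: "bit Matrix.vec"
    assume x: "x \<in> carrier_vec n" "x \<noteq> 0\<^sub>v n" and nN: "n \<in> N" and n: "n = 2 ^ T"
      and b: "1 \<le> b" "b \<le> n div \<Delta> n"
    define i where "i = b * \<Delta> n"
    define Z where "Z = {H \<in> ensemble n L. acc_mat T i H *\<^sub>v x = 0\<^sub>v i}"
    have adm: "R1 (avg_deg L) * real n \<in> \<int>" "\<Delta> n > 0" using assms(3)[OF nN] by (auto simp: admissible_def)
    have "b * \<Delta> n \<le> n div \<Delta> n * \<Delta> n" using b by (intro mult_le_mono1)
    also have "\<dots> \<le> n" by (rule div_times_less_eq_dividend)
    finally have i: "1 \<le> i" "i \<le> 2 ^ T" using b adm by (auto simp: i_def n Suc_le_eq)
    have rn: "real n = 2 ^ T" by (simp add: n)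
    show "ereal (measure (uniform_count_measure (ensemble n L)) {H \<in> ensemble n L. acc_mat T (b * \<Delta> n) H *\<^sub>v x = 0\<^sub>v (b * \<Delta> n)})
       \<le> eexp (ereal (real n) * Pexp (real (b * \<Delta> n) / real n) (avg_deg L) (avg_deg_supp n L (supp x)) +
               ereal (corr n (b * \<Delta> n) L (supp x) + (ln D + 5/4)))"
      unfolding i_def[symmetric] Z_def[symmetric]
    proof (cases "ensemble n L = {}")
      \<comment> \<open>An empty ensemble provides no \<open>H0\<close> for the locale; the measure
        is then 0 and \<open>eexp\<close> is nonnegative.\<close>
      case True
      then have "measure (uniform_count_measure (ensemble n L)) Z = 0"
        by (simp add: Z_def)
      moreover have "0 \<le> eexp y" for y by (cases y) (simp_all add: eexp_def)
      ultimately show "ereal (measure (uniform_count_measure (ensemble n L)) Z)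
        \<le> eexp (ereal (real n) * Pexp (real i / real n) (avg_deg L) (avg_deg_supp n L (supp x)) +
               ereal (corr n i L (supp x) + (ln D + 5/4)))" by (simp only: zero_ereal_def[symmetric])
    next
      case False
      then obtain H0 where "H0 \<in> ensemble n L" by blast
      then interpret ensemble_sockets n L H0 by unfold_locales
      have D: "D = simple_const" by (simp add: D_def k_def simple_const_def Let_def)
      have X: "measure (uniform_count_measure (ensemble n L)) Z = real (card Z) / real (card (ensemble n L))"
        by (rule measure_uniform_count_measure) (auto simp: finite_ensemble Z_def)
      define \<kappa> where "\<kappa> = supp x"
      define w where "w = card {s\<in>sockets. fst s \<in> \<kappa>}"
      have \<kappa>: "\<kappa> \<subseteq> {..<n}" using x by (auto simp: \<kappa>_def supp_def)
      have w: "real w = avg_deg_supp n L \<kappa> * 2 ^ T"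
        unfolding w_def card_support_sockets[OF \<kappa>] sum_deg_supp[OF \<kappa>] rn ..
      have m: "real (card sockets) = avg_deg L * 2 ^ T" unfolding card_sockets rn ..
      have "\<exists>j<n. vec_index x j \<noteq> 0" using x by (metis carrier_vecD eq_vecI index_zero_vec)
      then obtain j where j: "j \<in> \<kappa>" using x by (auto simp: \<kappa>_def supp_def)
      then have jn: "j < n" using \<kappa> by auto
      have "deg j > 0" using deg_ge[OF jn] assms(2) by linarith
      then have "0 < (\<Sum>j\<in>\<kappa>. deg j)"
        using j \<kappa> by (intro sum_pos2[of \<kappa> j]) (auto intro: finite_subset)
      then have w0: "0 < w" by (simp add: w_def card_support_sockets[OF \<kappa>])
      have wm: "w \<le> card sockets" unfolding w_def by (intro card_mono finite_sockets) auto
      have "R1 (avg_deg L) * real n \<ge> 0" using R1_pos[of "avg_deg L"] by simp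
      then obtain a where a: "real a = R1 (avg_deg L) * 2 ^ T"
        using adm(1) unfolding rn by (metis Ints_cases of_int_0_le_iff of_nat_nat of_int_of_nat_eq)
      have C: "1 / 2 * ln (real w * (1 - real w / real (card sockets))) \<le> corr n i L \<kappa>"
      proof -
        have "real w = real n * avg_deg_supp n L \<kappa>" unfolding w rn by (rule mult.commute)
        moreover have "real w / real (card sockets) = avg_deg_supp n L \<kappa> / avg_deg L" unfolding w m by simp
        ultimately show ?thesis using corr_ge[of n L \<kappa> i] lb by (simp add: n)
      qed
      have "real (card Z) / real (card (ensemble n L)) * real (card sockets choose w) * \<tau> ^ w
          \<le> D * exp (2 ^ T * log_gf (real i / 2 ^ T) (avg_deg L) \<tau>)" if "\<tau> > 0" for \<tau>
        unfolding D w_def \<kappa>_def Z_def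
        by (rule kernel_fraction_bound[OF assms(1,2) n i x(1) a that])
      then show "ereal (measure (uniform_count_measure (ensemble n L)) Z)
        \<le> eexp (ereal (real n) * Pexp (real i / real n) (avg_deg L) (avg_deg_supp n L (supp x)) +
               ereal (corr n i L (supp x) + (ln D + 5/4)))"
        unfolding X rn \<kappa>_def[symmetric]
        using simple_const_ge_1
        by (intro exponent_bound[OF i a refl lb m w w0 wm _ _ _ C]) (simp_all add: D)
    qed
  qed simp
qed

end
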